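(* Let the random designs $\xi_n$, $n\ge n_{\mathrm{st}}$, be generated by the adaptive Wynn-algorithm described in the context using the sequence of estimators $\widehat{\theta}_n$, $n\ge n_{\mathrm{st}}$. If $\widehat{\theta}_n\to\overline{\theta}$ almost surely, then for any sequence $\widehat{\theta}_n'$ of ($\Theta$-valued) estimators such that $\widehat{\theta}_n'\to\overline{\theta}$ almost surely one has $$M(\xi_n,\widehat{\theta}_n')\ \longrightarrow\ M(\xi^*_{\overline{\theta}},\overline{\theta})\quad\text{almost surely as } n\to\infty,$$ where $\xi^*_{\overline{\theta}}$ is a locally D-optimal design at $\overline{\theta}$.
   Context: Let $p\in\mathbb{N}$, let $\mathcal{X}$ and $\Theta$ be nonempty compact metric spaces and $\overline{\theta}\in\Theta$ (the true parameter point). For each $\theta\in\Theta$ a function $f_\theta:\mathcal{X}\to\mathbb{R}^p$ is given such that $\mathrm{span}\{f_\theta(x):x\in\mathcal{X}\}=\mathbb{R}^p$ for every $\theta\in\Theta$, and $(x,\theta)\mapsto f_\theta(x)$ is continuous on $\mathcal{X}\times\Theta$. A design $\xi$ is a probability measure on $\mathcal{X}$ with finite support, with weights $\xi(x)$; $M(\xi,\theta)=\sum_{x\in\mathrm{supp}(\xi)}\xi(x)f_\theta(x)f_\theta(x)^{T}$. A locally D-optimal design at $\overline{\theta}$ is a design maximizing $\det M(\xi,\overline{\theta})$ over all designs $\xi$. $\delta_x$ is the point mass at $x$. On a probability space there are $\mathcal{X}$-valued random variables $X_i$ (design points) and real random variables $Y_i$ (responses), $i\in\mathbb{N}$, and $\Theta$-valued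 estimators $\widehat{\theta}_n=\widehat{\theta}_n(X_1,Y_1,\dots,X_n,Y_n)$, $n\ge n_{\mathrm{st}}$, where $n_{\mathrm{st}}\in\mathbb{N}$. Adaptive Wynn-algorithm: $\xi_n=\frac1n\sum_{i=1}^n\delta_{X_i}$ for $n\ge n_{\mathrm{st}}$; the starting design satisfies that $M(\xi_{n_{\mathrm{st}}},\theta)$ is positive definite for all $\theta\in\Theta$; and for each $n\ge n_{\mathrm{st}}$, $X_{n+1}$ is (pathwise) a maximizer over $x\in\mathcal{X}$ of $f_{\widehat{\theta}_n}(x)^{T}M^{-1}(\xi_n,\widehat{\theta}_n)f_{\widehat{\theta}_n}(x)$. No assumption on the joint distribution of the $X_i,Y_i$ beyond this is used. *)

theory Defs
  imports "HOL-Probability.Probability"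
begin

text \<open>
  Compact metric spaces are compact subsets \<open>XX\<close>, \<open>\<Theta>\<close> of metric space types;
  the regression function is only constrained on \<open>XX \<times> \<Theta>\<close>.
\<close>

definition regression_family ::
    "'x::metric_space set \<Rightarrow> 't::metric_space set \<Rightarrow> ('t \<Rightarrow> 'x \<Rightarrow> real ^ 'p) \<Rightarrow> bool"
  where "regression_family XX \<Theta> f \<longleftrightarrow>
    (\<forall>\<theta>\<in>\<Theta>. span (f \<theta> ` XX) = UNIV) \<and>
    continuous_on (XX \<times> \<Theta>) (\<lambda>(x, \<theta>). f \<theta> x)"

definition design :: "'x set \<Rightarrow> 'x pmf \<Rightarrow> bool"
  where "design XX \<xi> \<longleftrightarrow> finite (set_pmf \<xi>) \<and> set_pmf \<xi> \<subseteq> XX"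

definition outer :: "real ^ 'p \<Rightarrow> real ^ 'p ^ 'p"
  where "outer v = (\<chi> i j. v $ i * v $ j)"

definition info :: "('t \<Rightarrow> 'x \<Rightarrow> real ^ 'p) \<Rightarrow> 'x pmf \<Rightarrow> 't \<Rightarrow> real ^ 'p ^ 'p"
  where "info f \<xi> \<theta> = (\<Sum>x\<in>set_pmf \<xi>. pmf \<xi> x *\<^sub>R outer (f \<theta> x))"

definition locally_D_optimal ::
    "'x set \<Rightarrow> ('t \<Rightarrow> 'x \<Rightarrow> real ^ 'p) \<Rightarrow> 't \<Rightarrow> 'x pmf \<Rightarrow> bool"
  where "locally_D_optimal XX f \<theta> \<xi> \<longleftrightarrow> is_arg_max (\<lambda>\<eta>. det (info f \<eta> \<theta>)) (design XX) \<xi>"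

definition pos_def :: "real ^ 'p ^ 'p \<Rightarrow> bool"
  where "pos_def A \<longleftrightarrow> transpose A = A \<and> (\<forall>v. v \<noteq> 0 \<longrightarrow> v \<bullet> (A *v v) > 0)"

text \<open>
  The mixture of the point masses at \<open>x 1, \<dots>, x n\<close> with equal weights \<open>1/n\<close>
  (repetitions allowed); meaningful for \<open>n \<ge> 1\<close> only.
\<close>

definition empirical_design :: "nat \<Rightarrow> (nat \<Rightarrow> 'x) \<Rightarrow> 'x pmf"
  where "empirical_design n x = bind_pmf (pmf_of_set {1..n}) (\<lambda>i. return_pmf (x i))"

lemma pmf_empirical_design:
  assumes "n \<ge> 1"
  shows "pmf (empirical_design n x) z = (\<Sum>i=1..n. pmf (return_pmf (x i)) z) / real n"
  using assms by (simp add: empirical_design_def pmf_bind_pmf_of_set)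

text \<open>
  An estimator based on \<open>n\<close> observations is a measurable \<open>\<Theta>\<close>-valued function of the
  data \<open>(x\<^sub>1, y\<^sub>1), \<dots>, (x\<^sub>n, y\<^sub>n)\<close>, which are encoded as an extensional function on \<open>{1..n}\<close>.
\<close>

definition estimator ::
    "'x::metric_space set \<Rightarrow> 't::metric_space set \<Rightarrow> nat \<Rightarrow> ((nat \<Rightarrow> 'x \<times> real) \<Rightarrow> 't) \<Rightarrow> bool"
  where "estimator XX \<Theta> n t \<longleftrightarrow>
    t \<in> measurable (PiM {1..n} (\<lambda>_. restrict_space borel XX \<Otimes>\<^sub>M borel)) (restrict_space borel \<Theta>)"

definition estimate ::
    "(nat \<Rightarrow> (nat \<Rightarrow> 'x \<times> real) \<Rightarrow> 't) \<Rightarrow> (nat \<Rightarrow> 'w \<Rightarrow> 'x) \<Rightarrow> (nat \<Rightarrow> 'w \<Rightarrow> real) \<Rightarrow> nat \<Rightarrow> 'w \<Rightarrow> 't"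
  where "estimate t X Y n \<omega> = t n (\<lambda>i\<in>{1..n}. (X i \<omega>, Y i \<omega>))"

text \<open>
  One path \<open>x\<close> of design points generated by the adaptive Wynn algorithm along the path \<open>th\<close>
  of parameter estimates.
\<close>

definition adaptive_wynn_path ::
    "'x set \<Rightarrow> 't set \<Rightarrow> ('t \<Rightarrow> 'x \<Rightarrow> real ^ 'p) \<Rightarrow> nat \<Rightarrow> (nat \<Rightarrow> 't) \<Rightarrow> (nat \<Rightarrow> 'x) \<Rightarrow> bool"
  where "adaptive_wynn_path XX \<Theta> f nst th x \<longleftrightarrow>
    (\<forall>\<theta>\<in>\<Theta>. pos_def (info f (empirical_design nst x) \<theta>)) \<and>
    (\<forall>n\<ge>nst. is_arg_max
       (\<lambda>z. f (th n) z \<bullet> (matrix_inv (info f (empirical_design n x) (th n)) *v f (th n) z))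
       (\<lambda>z. z \<in> XX) (x (Suc n)))"

end

theory Submission
  imports Defs
begin

text \<open>
  Everything happens on a single path on which both sequences of estimates converge, so let the
  points \<open>x\<^sub>i\<close> and the estimates \<open>\<theta>\<^sub>n \<rightarrow> \<theta>bar\<close> be deterministic. Write \<open>A\<^sub>n\<close> for the information matrix
  of the design \<open>\<xi>\<^sub>n\<close> at the limit point \<open>\<theta>bar\<close>. By uniform continuity of \<open>f\<close> on the compact set
  \<open>XX \<times> \<Theta>\<close>, evaluating the information matrices at any estimates that converge to \<open>\<theta>bar\<close> changes
  them by \<open>o(1)\<close> (lemma \<open>M_close\<close>), so the claim is that \<open>A\<^sub>n\<close> tends to the D-optimal matrix.

  At \<open>\<theta>bar\<close> the algorithm is then a steepest ascent for \<open>ln det\<close> with step size \<open>1/n\<close>, disturbed by the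
  estimation error. Let \<open>\<Delta>\<^sub>n\<close> be the gap between the maximum of \<open>ln det\<close> and \<open>ln det A\<^sub>n\<close>, and call
  \<open>f(z) \<bullet> A\<^sub>n\<^sup>-\<^sup>1 f(z)\<close> the sensitivity at \<open>z\<close>. Concavity of \<open>ln det\<close> bounds \<open>\<Delta>\<^sub>n\<close> by the largest
  sensitivity minus \<open>p\<close> (lemma \<open>det_weighted_gram_le\<close>), while adding a point of sensitivity \<open>d\<close> raises
  \<open>ln det\<close> by about \<open>(d - p)/n\<close> (lemma \<open>det_rank_one_update_ge\<close>). If the new point is nearly the most
  sensitive one, then \<open>\<Delta>\<^sub>n\<^sub>+\<^sub>1 \<le> (1 - 1/n) \<Delta>\<^sub>n + o(1/n)\<close>, which forces \<open>\<Delta>\<^sub>n \<rightarrow> 0\<close> (lemma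
  \<open>relaxation_tendsto_zero\<close>). Strict log-concavity of the determinant makes the maximal matrix
  unique, and compactness turns convergence of determinants into convergence of matrices (lemma
  \<open>tendsto_if_det_tendsto\<close>).

  The new point maximises the sensitivity at \<open>\<theta>\<^sub>n\<close>, and transferring this to \<open>\<theta>bar\<close> needs bounded inverses:
  the smallest eigenvalue of \<open>A\<^sub>n\<close> has to stay away from zero, whereas the starting design alone only
  gives a bound of order \<open>1/n\<close>. This is the crux (lemma \<open>M_eventually_coercive\<close>). If the largest
  sensitivity \<open>D\<close> at time \<open>n\<close> is big, then the linear functional \<open>u = M\<^sub>n\<^sup>-\<^sup>1 f(x\<^sub>n\<^sub>+\<^sub>1)\<close> takes the value \<open>D\<close>
  at the new point but has mean square \<open>D\<close> over the earlier ones, and its norm is \<open>O(D)\<close>. Hence all but a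
  fraction \<open>4/D\<close> of the earlier regression vectors keep a fixed distance from the new one (lemma
  \<open>few_points_near_direction\<close>). These vectors stay in a compact set, which finitely many small cells cover, so
  by pigeonhole this cannot happen at every time between \<open>m\<close> and \<open>2m\<close> (lemma \<open>colour_count\<close>). At some
  time in that range all sensitivities are bounded, thus the information matrix is bounded
  below, and since \<open>n A\<^sub>n\<close> increases with \<open>n\<close>, the bound survives up to a constant until the next such time.
\<close>

section \<open>Positive definite matrices\<close>

lemma pos_def_pos: "pos_def A \<Longrightarrow> v \<noteq> 0 \<Longrightarrow> 0 < v \<bullet> (A *v v)"
  by (simp add: pos_def_def)

lemma pos_def_nonneg: "pos_def A \<Longrightarrow> 0 \<le> v \<bullet> (A *v v)"
  by (cases "v = 0") (auto simp: pos_def_def less_imp_le)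

lemma symmetric_dot:
  fixes A :: "real ^ 'p ^ 'p"
  assumes "transpose A = A"
  shows "(A *v v) \<bullet> w = v \<bullet> (A *v w)"
  by (metis assms dot_lmul_matrix transpose_matrix_vector)

lemma pos_def_invertible:
  fixes A :: "real ^ 'p ^ 'p"
  assumes "pos_def A"
  shows "invertible A"
proof -
  have "\<forall>v. A *v v = 0 \<longrightarrow> v = 0"
    using pos_def_pos[OF assms] by force
  then show ?thesis
    by (meson invertible_left_inverse matrix_left_invertible_ker)
qed

lemma pos_def_inv_cancel:
  fixes A :: "real ^ 'p ^ 'p"
  assumes "pos_def A"
  shows "A *v (matrix_inv A *v v) = v" "matrix_inv A *v (A *v v) = v"
proof -
  have "\<exists>B. A ** B = mat 1 \<and> B ** A = mat 1"
    using pos_def_invertible[OF assms] by (simp add: invertible_def)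
  then have "A ** matrix_inv A = mat 1 \<and> matrix_inv A ** A = mat 1"
    unfolding matrix_inv_def by (rule someI_ex)
  then show "A *v (matrix_inv A *v v) = v" "matrix_inv A *v (A *v v) = v"
    by (simp_all add: matrix_vector_mul_assoc)
qed

lemma pos_def_inv_dot:
  fixes A :: "real ^ 'p ^ 'p"
  assumes "pos_def A"
  shows "(matrix_inv A *v v) \<bullet> w = v \<bullet> (matrix_inv A *v w)"
proof -
  have "v \<bullet> (matrix_inv A *v w) = (A *v (matrix_inv A *v v)) \<bullet> (matrix_inv A *v w)"
    by (simp add: pos_def_inv_cancel[OF assms])
  also have "\<dots> = (matrix_inv A *v v) \<bullet> (A *v (matrix_inv A *v w))"
    using assms by (intro symmetric_dot) (simp add: pos_def_def)
  finally show ?thesis by (simp add: pos_def_inv_cancel[OF assms])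
qed

lemma pos_def_inv_nonneg:
  fixes A :: "real ^ 'p ^ 'p"
  assumes "pos_def A"
  shows "0 \<le> v \<bullet> (matrix_inv A *v v)"
  using pos_def_nonneg[OF assms, of "matrix_inv A *v v"]
  by (simp add: pos_def_inv_cancel[OF assms] inner_commute)

lemma pos_def_Cauchy_Schwarz:
  fixes A :: "real ^ 'p ^ 'p"
  assumes "pos_def A"
  shows "(v \<bullet> (A *v w))\<^sup>2 \<le> (v \<bullet> (A *v v)) * (w \<bullet> (A *v w))"
proof (cases "w = 0")
  case False
  define q where "q = w \<bullet> (A *v w)"
  define b where "b = v \<bullet> (A *v w)"
  have q: "q > 0" using pos_def_pos[OF assms False] by (simp add: q_def)
  have b': "w \<bullet> (A *v v) = b"
    using symmetric_dot[of A w v] assms by (simp add: b_def pos_def_def inner_commute)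
  have "0 \<le> (v - (b/q) *\<^sub>R w) \<bullet> (A *v (v - (b/q) *\<^sub>R w))"
    by (rule pos_def_nonneg[OF assms])
  also have "\<dots> = v \<bullet> (A *v v) - (b/q) * b - (b/q) * b + (b/q) * (b/q) * q"
    by (simp add: matrix_vector_mult_diff_distrib matrix_vector_mult_scaleR inner_diff_left
        inner_diff_right b' flip: q_def b_def)
  also have "\<dots> = v \<bullet> (A *v v) - b\<^sup>2 / q"
    using q by (simp add: field_simps power2_eq_square)
  finally show ?thesis
    using q by (simp add: field_simps flip: q_def b_def)
qed simp

text \<open>
  Both are the Cauchy-Schwarz inequality of the inner product given by \<open>A\<close>. The second one bounds the
  form of \<open>A\<close> from below once that of the inverse is known to be bounded on a set of vectors that sees
  every direction.
\<close>
lemma pos_def_inv_Cauchy_Schwarz: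
  fixes A :: "real ^ 'p ^ 'p"
  assumes "pos_def A"
  shows "(v \<bullet> (matrix_inv A *v w))\<^sup>2 \<le> (v \<bullet> (matrix_inv A *v v)) * (w \<bullet> (matrix_inv A *v w))"
    and "(v \<bullet> w)\<^sup>2 \<le> (v \<bullet> (matrix_inv A *v v)) * (w \<bullet> (A *v w))"
proof -
  show "(v \<bullet> (matrix_inv A *v w))\<^sup>2 \<le> (v \<bullet> (matrix_inv A *v v)) * (w \<bullet> (matrix_inv A *v w))"
    using pos_def_Cauchy_Schwarz[OF assms, of "matrix_inv A *v v" "matrix_inv A *v w"]
    by (simp only: pos_def_inv_cancel[OF assms] pos_def_inv_dot[OF assms])
  have "(matrix_inv A *v v) \<bullet> (A *v w) = v \<bullet> w"
    by (simp only: pos_def_inv_cancel[OF assms] pos_def_inv_dot[OF assms])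
  then show "(v \<bullet> w)\<^sup>2 \<le> (v \<bullet> (matrix_inv A *v v)) * (w \<bullet> (A *v w))"
    using pos_def_Cauchy_Schwarz[OF assms, of "matrix_inv A *v v" w]
    by (simp only: pos_def_inv_cancel[OF assms] pos_def_inv_dot[OF assms])
qed

lemma pos_def_coercive:
  fixes A :: "real ^ 'p ^ 'p"
  assumes "pos_def A"
  obtains c where "c > 0" "\<And>v. c * (norm v)\<^sup>2 \<le> v \<bullet> (A *v v)"
proof -
  have cont: "continuous_on (sphere 0 1) (\<lambda>v::real^'p. v \<bullet> (A *v v))"
    by (intro continuous_intros linear_continuous_on matrix_vector_mul_bounded_linear)
  have "sphere (0::real^'p) 1 \<noteq> {}" by simp
  from continuous_attains_inf[OF compact_sphere this cont]
  obtain u where u: "u \<in> sphere 0 1"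
    and min: "\<forall>v\<in>sphere 0 1. u \<bullet> (A *v u) \<le> v \<bullet> (A *v v)"
    by blast
  show ?thesis
  proof
    show "0 < u \<bullet> (A *v u)"
      using u by (intro pos_def_pos[OF assms]) auto
    fix v :: "real^'p"
    show "u \<bullet> (A *v u) * (norm v)\<^sup>2 \<le> v \<bullet> (A *v v)"
    proof (cases "v = 0")
      case False
      have "u \<bullet> (A *v u) \<le> ((1 / norm v) *\<^sub>R v) \<bullet> (A *v ((1 / norm v) *\<^sub>R v))"
        using False by (intro min[rule_format]) simp
      then show ?thesis
        using False by (simp add: matrix_vector_mult_scaleR field_simps power2_eq_square)
    qed simp
  qed
qed

text \<open>
  Greedy construction of a basis that is orthonormal for \<open>A\<close> and orthogonal for \<open>B\<close>: the next vector
  maximises the form of \<open>B\<close> on the \<open>A\<close>-unit sphere of the \<open>A\<close>-orthogonal complement of the previous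
  ones. Stationarity at the maximiser says that whatever is \<open>A\<close>-orthogonal to all chosen vectors is
  also \<open>B\<close>-orthogonal to them; this last clause is the invariant that drives the induction.
\<close>
lemma pos_def_simultaneous_basis:
  fixes A B :: "real ^ 'p ^ 'p"
  assumes A: "pos_def A" and B: "transpose B = B" and "k \<le> CARD('p)"
  shows "\<exists>S. finite S \<and> card S = k \<and>
    (\<forall>s\<in>S. s \<bullet> (A *v s) = 1) \<and>
    (\<forall>s\<in>S. \<forall>t\<in>S. s \<noteq> t \<longrightarrow> s \<bullet> (A *v t) = 0) \<and>
    (\<forall>s\<in>S. \<forall>t\<in>S. s \<noteq> t \<longrightarrow> s \<bullet> (B *v t) = 0) \<and>
    (\<forall>w. (\<forall>s\<in>S. w \<bullet> (A *v s) = 0) \<longrightarrow> (\<forall>s\<in>S. w \<bullet> (B *v s) = 0))"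
  using \<open>k \<le> CARD('p)\<close>
proof (induction k)
  case 0
  show ?case by (intro exI[of _ "{}"]) auto
next
  case (Suc k)
  from Suc.IH[OF Suc_leD[OF Suc.prems]] obtain S where S: "finite S" "card S = k"
    and S1: "\<forall>s\<in>S. s \<bullet> (A *v s) = 1"
    and SA: "\<forall>s\<in>S. \<forall>t\<in>S. s \<noteq> t \<longrightarrow> s \<bullet> (A *v t) = 0"
    and SB: "\<forall>s\<in>S. \<forall>t\<in>S. s \<noteq> t \<longrightarrow> s \<bullet> (B *v t) = 0"
    and inv: "\<forall>w. (\<forall>s\<in>S. w \<bullet> (A *v s) = 0) \<longrightarrow> (\<forall>s\<in>S. w \<bullet> (B *v s) = 0)"
    by (elim exE conjE)
  have symA: "transpose A = A" using A by (simp add: pos_def_def)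
  have cA: "w \<bullet> (A *v v) = v \<bullet> (A *v w)" for v w
    using symmetric_dot[OF symA, of v w] by (simp add: inner_commute)
  have cB: "w \<bullet> (B *v v) = v \<bullet> (B *v w)" for v w
    using symmetric_dot[OF B, of v w] by (simp add: inner_commute)
  obtain c where c: "c > 0" "\<And>v. c * (norm v)\<^sup>2 \<le> v \<bullet> (A *v v)"
    using pos_def_coercive[OF A] by blast
  define W where "W = {w. \<forall>s\<in>S. w \<bullet> (A *v s) = 0}"
  define E where "E = W \<inter> {w. w \<bullet> (A *v w) = 1}"
  have cont: "continuous_on UNIV (\<lambda>v::real^'p. v \<bullet> (C *v v))" for C :: "real^'p^'p"
    by (intro continuous_intros linear_continuous_on matrix_vector_mul_bounded_linear)
  have "closed W"
  proof -
    have "W = (\<Inter>s\<in>S. {w. w \<bullet> (A *v s) = 0})" by (auto simp: W_def)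
    then show ?thesis
      by (simp add: closed_INT closed_Collect_eq continuous_intros)
  qed
  moreover have "closed {w::real^'p. w \<bullet> (A *v w) = 1}"
    by (intro closed_Collect_eq cont continuous_intros)
  ultimately have "closed E" by (auto simp: E_def)
  moreover have "bounded E"
  proof (rule boundedI)
    fix w assume "w \<in> E"
    then have "c * (norm w)\<^sup>2 \<le> 1" using c(2)[of w] by (auto simp: E_def)
    then have "(norm w)\<^sup>2 \<le> (sqrt (1/c))\<^sup>2"
      using c(1) by (simp add: field_simps)
    then show "norm w \<le> sqrt (1/c)"
      by (rule power2_le_imp_le) (use c(1) in auto)
  qed
  ultimately have "compact E" by (simp add: compact_eq_bounded_closed)
  have norm1: "(1 / sqrt (w \<bullet> (A *v w))) *\<^sub>R w \<in> E" if "w \<in> W" "w \<noteq> 0" for w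
    using that pos_def_pos[OF A, of w]
    by (auto simp: E_def W_def matrix_vector_mult_scaleR simp flip: real_sqrt_mult)
  have "dim ((*v) A ` S) < CARD('p)"
  proof -
    have "dim ((*v) A ` S) \<le> card ((*v) A ` S)"
      using S by (intro dim_le_card') auto
    also have "\<dots> \<le> k" using S card_image_le by blast
    finally show ?thesis using Suc.prems by simp
  qed
  then have "span ((*v) A ` S) \<noteq> UNIV"
    by (metis dim_UNIV dim_span less_irrefl DIM_cart DIM_real mult_1_right)
  then obtain w0 where "w0 \<noteq> 0" and w0: "\<And>x. x \<in> span ((*v) A ` S) \<Longrightarrow> orthogonal w0 x"
    using orthogonal_to_subspace_exists_gen[of "(*v) A ` S" UNIV]
    by (metis UNIV_I span_UNIV psubsetI subset_UNIV)
  have "w0 \<in> W"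
    using w0[OF span_base] by (auto simp: W_def orthogonal_def)
  then have "E \<noteq> {}" using norm1[OF _ \<open>w0 \<noteq> 0\<close>] by blast
  obtain v where "v \<in> E" and max: "\<And>w. w \<in> E \<Longrightarrow> w \<bullet> (B *v w) \<le> v \<bullet> (B *v v)"
    using continuous_attains_sup[OF \<open>compact E\<close> \<open>E \<noteq> {}\<close> continuous_on_subset[OF cont[of B]]] by auto
  have v: "v \<bullet> (A *v v) = 1" "\<And>s. s \<in> S \<Longrightarrow> v \<bullet> (A *v s) = 0"
    using \<open>v \<in> E\<close> by (auto simp: E_def W_def)
  define m where "m = v \<bullet> (B *v v)"
  have le: "w \<bullet> (B *v w) \<le> m * (w \<bullet> (A *v w))" if "w \<in> W" for w
  proof (cases "w = 0")
    case False
    show ?thesis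
      using max[OF norm1[OF that False]] pos_def_pos[OF A False]
      by (simp add: matrix_vector_mult_scaleR m_def field_simps flip: real_sqrt_mult)
  qed simp
  have new: "w \<bullet> (B *v v) = 0" if w: "w \<in> W" "w \<bullet> (A *v v) = 0" for w
  proof -
    define b where "b = w \<bullet> (B *v v)"
    define K where "K = m * (w \<bullet> (A *v w)) - w \<bullet> (B *v w)"
    have 1: "2 * t * b \<le> t\<^sup>2 * K" for t
    proof -
      have "v + t *\<^sub>R w \<in> W"
        using w(1) v(2) by (auto simp: W_def inner_add_left)
      note le[OF this]
      moreover have "(v + t *\<^sub>R w) \<bullet> (B *v (v + t *\<^sub>R w)) = m + 2 * t * b + t\<^sup>2 * (w \<bullet> (B *v w))"
        using cB[of v w]
        by (simp add: matrix_vector_right_distrib matrix_vector_mult_scaleR inner_add_left inner_add_right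
          power2_eq_square m_def b_def algebra_simps)
      moreover have "(v + t *\<^sub>R w) \<bullet> (A *v (v + t *\<^sub>R w)) = 1 + t\<^sup>2 * (w \<bullet> (A *v w))"
        using cA[of v w] w(2) v(1)
        by (simp add: matrix_vector_right_distrib matrix_vector_mult_scaleR inner_add_left inner_add_right
          power2_eq_square algebra_simps)
      ultimately have "m + 2 * t * b + t\<^sup>2 * (w \<bullet> (B *v w)) \<le> m * (1 + t\<^sup>2 * (w \<bullet> (A *v w)))"
        by simp
      then show ?thesis by (simp add: K_def algebra_simps)
    qed
    have "K \<ge> 0" using le[OF w(1)] by (simp add: K_def)
    \<comment> \<open>A linear term in \<open>t\<close> is dominated by a quadratic one; a small \<open>t\<close> of the sign of \<open>b\<close> shows \<open>b = 0\<close>.\<close>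
    have "2 * (b / (K+1)) * b \<le> (b / (K+1))\<^sup>2 * K" by (rule 1)
    also have "\<dots> \<le> (b / (K+1))\<^sup>2 * (K+1)" by (intro mult_left_mono) auto
    also have "\<dots> = (b / (K+1)) * b" using \<open>K \<ge> 0\<close> by (simp add: power2_eq_square)
    finally have "b * b / (K+1) \<le> 0" by simp
    then have "b = 0" using \<open>K \<ge> 0\<close> by (auto simp: divide_le_0_iff mult_le_0_iff)
    then show ?thesis by (simp add: b_def)
  qed
  have "v \<notin> S" using v by force
  have vS: "v \<bullet> (A *v s) = 0" "s \<bullet> (A *v v) = 0" "v \<bullet> (B *v s) = 0" "s \<bullet> (B *v v) = 0" if "s \<in> S" for s
  proof -
    show "v \<bullet> (A *v s) = 0" by (rule v(2)[OF that])
    then show "s \<bullet> (A *v v) = 0" by (simp only: cA[of s])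
    show "v \<bullet> (B *v s) = 0" using inv v(2) that by blast
    then show "s \<bullet> (B *v v) = 0" by (simp only: cB[of s])
  qed
  show ?case
  proof (intro exI[of _ "insert v S"] conjI ballI allI impI)
    fix s t assume "s \<in> insert v S" "t \<in> insert v S" "s \<noteq> t"
    then show "s \<bullet> (A *v t) = 0" "s \<bullet> (B *v t) = 0"
      using SA SB vS by blast+
  next
    fix w s assume w: "\<forall>s\<in>insert v S. w \<bullet> (A *v s) = 0" and "s \<in> insert v S"
    then have "w \<in> W" "w \<bullet> (A *v v) = 0" by (simp_all add: W_def)
    then show "w \<bullet> (B *v s) = 0"
      using \<open>s \<in> insert v S\<close> inv new unfolding W_def by blast
  qed (use S S1 v \<open>v \<notin> S\<close> in auto)
qed

lemma matrix_conj_nth: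
  fixes S B :: "real ^ 'p ^ 'p"
  shows "(transpose S ** B ** S) $ i $ j = column i S \<bullet> (B *v column j S)"
proof -
  have "(transpose S ** (B ** S)) $ i $ j = row i (transpose S) \<bullet> column j (B ** S)"
    by (simp add: matrix_mult_dot row_def column_def inner_vec_def matrix_matrix_mult_def)
  moreover have "column j (B ** S) = B *v column j S"
    by (simp add: column_def matrix_matrix_mult_def matrix_vector_mult_def vec_eq_iff)
  ultimately show ?thesis by (simp add: matrix_mul_assoc)
qed

lemma pos_def_simultaneous_diagonalisation:
  fixes A B :: "real ^ 'p ^ 'p"
  assumes A: "pos_def A" and B: "transpose B = B"
  shows "\<exists>S :: real ^ 'p ^ 'p. transpose S ** A ** S = mat 1 \<and>
    (\<forall>i j. i \<noteq> j \<longrightarrow> column i S \<bullet> (B *v column j S) = 0)"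
proof -
  from pos_def_simultaneous_basis[OF A B order_refl]
  obtain T where T: "finite T" "card T = CARD('p)"
    and T1: "\<forall>s\<in>T. s \<bullet> (A *v s) = 1"
    and TA: "\<forall>s\<in>T. \<forall>t\<in>T. s \<noteq> t \<longrightarrow> s \<bullet> (A *v t) = 0"
    and TB: "\<forall>s\<in>T. \<forall>t\<in>T. s \<noteq> t \<longrightarrow> s \<bullet> (B *v t) = 0"
    by (elim exE conjE)
  obtain h where h: "bij_betw h (UNIV :: 'p set) T"
    using T finite_same_card_bij[of "UNIV :: 'p set" T] by auto
  define S :: "real ^ 'p ^ 'p" where "S = (\<chi> i j. h j $ i)"
  have col: "column j S = h j" for j by (simp add: column_def S_def vec_eq_iff)
  have hT: "h j \<in> T" and hinj: "h i = h j \<longleftrightarrow> i = j" for i j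
    using h by (auto simp: bij_betw_def inj_on_def)
  show ?thesis
  proof (intro exI[of _ S] conjI allI impI)
    have "(transpose S ** A ** S) $ i $ j = (mat 1 :: real ^ 'p ^ 'p) $ i $ j" for i j
      using T1 TA hT hinj[of i j] by (auto simp: matrix_conj_nth col mat_def)
    then show "transpose S ** A ** S = mat 1" by (simp add: vec_eq_iff)
    show "column i S \<bullet> (B *v column j S) = 0" if "i \<noteq> j" for i j
      using that TB hT hinj by (simp add: col)
  qed
qed

section \<open>Determinants of positive definite matrices\<close>

text \<open>
  The \<open>d i\<close> are the eigenvalues of the pencil, that is of \<open>A\<^sup>-\<^sup>1 B\<close>. Every determinant inequality
  below becomes an inequality between products of numbers in these coordinates.
\<close>
definition diagonalises ::
    "real ^ 'p ^ 'p \<Rightarrow> real ^ 'p ^ 'p \<Rightarrow> real ^ 'p ^ 'p \<Rightarrow> ('p \<Rightarrow> real) \<Rightarrow> bool"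
  where "diagonalises S A B d \<longleftrightarrow>
    transpose S ** A ** S = mat 1 \<and>
    transpose S ** B ** S = (\<chi> i j. if i = j then d i else 0)"

lemma diagonalises_exists:
  fixes A B :: "real ^ 'p ^ 'p"
  assumes "pos_def A" and "transpose B = B"
  shows "\<exists>S d. diagonalises S A B d"
proof -
  from pos_def_simultaneous_diagonalisation[OF assms]
  obtain S :: "real ^ 'p ^ 'p" where S: "transpose S ** A ** S = mat 1"
    and SB: "\<forall>i j. i \<noteq> j \<longrightarrow> column i S \<bullet> (B *v column j S) = 0"
    by (elim exE conjE)
  then have "diagonalises S A B (\<lambda>i. column i S \<bullet> (B *v column i S))"
    by (auto simp: diagonalises_def vec_eq_iff[of "_ ** B ** _"] vec_eq_iff[of "(_ ** B ** _) $ _"] matrix_conj_nth)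
  then show ?thesis by blast
qed

text \<open>
  The inverse of \<open>A\<close> is \<open>S S\<^sup>T\<close>, which gives its quadratic form as a sum of squares over the columns
  of \<open>S\<close>; the remaining facts are the multiplicativity of the determinant and cancellation of \<open>S\<close>.
\<close>
lemma
  fixes S A B :: "real ^ 'p ^ 'p"
  assumes D: "diagonalises S A B d" and A: "pos_def A"
  shows diagonalises_det_nonzero: "det S \<noteq> 0"
    and diagonalises_eigenvalue: "d i = column i S \<bullet> (B *v column i S)"
    and diagonalises_det: "det (a *\<^sub>R A + b *\<^sub>R B) * (det S)\<^sup>2 = (\<Prod>i\<in>UNIV. a + b * d i)"
    and diagonalises_inverse: "(\<Sum>i\<in>UNIV. (column i S \<bullet> v)\<^sup>2) = v \<bullet> (matrix_inv A *v v)"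
    and diagonalises_eq: "(\<And>i. d i = 1) \<Longrightarrow> B = A"
proof -
  have SA: "transpose S ** A ** S = mat 1"
    and SB: "transpose S ** B ** S = (\<chi> i j. if i = j then d i else 0)"
    using D by (auto simp: diagonalises_def)
  have SB': "column i S \<bullet> (B *v column j S) = (if i = j then d i else 0)" for i j
    using arg_cong[OF SB, of "\<lambda>M. M $ i $ j"] by (simp add: matrix_conj_nth)
  have SA': "column i S \<bullet> (A *v column j S) = (if i = j then 1 else 0)" for i j
    using arg_cong[OF SA, of "\<lambda>M. M $ i $ j"] by (simp add: matrix_conj_nth mat_def)
  have "det (transpose S ** A ** S) = 1" using SA by simp
  then have detS: "det S \<noteq> 0" by (auto simp: det_mul)
  have inv1: "S ** (transpose S ** A) = mat 1"
    using SA by (metis matrix_left_right_inverse)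
  have inv2: "(A ** S) ** transpose S = mat 1"
    using SA by (metis matrix_left_right_inverse matrix_mul_assoc)
  have inv: "matrix_inv A *v v = S *v (transpose S *v v)" for v
  proof -
    have "matrix_inv A *v v = (S ** (transpose S ** A)) *v (matrix_inv A *v v)"
      by (simp add: inv1)
    also have "\<dots> = S *v (transpose S *v (A *v (matrix_inv A *v v)))"
      by (simp only: matrix_vector_mul_assoc matrix_mul_assoc)
    finally show ?thesis by (simp add: pos_def_inv_cancel[OF A])
  qed
  show "det S \<noteq> 0" by (rule detS)
  show "d i = column i S \<bullet> (B *v column i S)" by (simp add: SB')
  have "(transpose S ** (a *\<^sub>R A + b *\<^sub>R B) ** S) $ i $ j = (if i = j then a + b * d i else 0)" for i j
    unfolding matrix_conj_nth
    by (simp add: matrix_vector_mult_add_rdistrib scaleR_matrix_vector_assoc[symmetric]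
        inner_add_right SA' SB')
  then have "det (transpose S ** (a *\<^sub>R A + b *\<^sub>R B) ** S) = (\<Prod>i\<in>UNIV. a + b * d i)"
    by (subst det_diagonal) auto
  then show "det (a *\<^sub>R A + b *\<^sub>R B) * (det S)\<^sup>2 = (\<Prod>i\<in>UNIV. a + b * d i)"
    by (simp add: det_mul power2_eq_square mult_ac)
  have col: "transpose S $ i = column i S" for i
    by (simp add: column_def transpose_def vec_eq_iff)
  have "v \<bullet> (matrix_inv A *v v) = (transpose S *v v) \<bullet> (transpose S *v v)"
    unfolding inv by (metis dot_lmul_matrix transpose_matrix_vector)
  also have "\<dots> = (\<Sum>i\<in>UNIV. (column i S \<bullet> v)\<^sup>2)"
    by (simp add: inner_vec_def[of "transpose S *v v"] matrix_vector_mul_component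
        col power2_eq_square del: transpose_matrix_vector)
  finally show "(\<Sum>i\<in>UNIV. (column i S \<bullet> v)\<^sup>2) = v \<bullet> (matrix_inv A *v v)" by simp
  assume d1: "\<And>i. d i = 1"
  have SBS: "transpose S ** B ** S = mat 1" unfolding SB mat_def d1 ..
  have "A = (A ** S) ** (transpose S ** B ** S) ** (transpose S ** A)"
    using inv2 by (simp add: SBS matrix_mul_assoc)
  also have "\<dots> = ((A ** S) ** transpose S) ** B ** (S ** (transpose S ** A))"
    by (simp only: matrix_mul_assoc)
  also have "\<dots> = B" by (simp add: inv1 inv2)
  finally show "B = A" by simp
qed

lemma pos_def_det_pos:
  fixes A :: "real ^ 'p ^ 'p"
  assumes A: "pos_def A"
  shows "det A > 0"
proof -
  have sym: "transpose A = A" using A by (simp add: pos_def_def)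
  obtain S d where D: "diagonalises S A A d"
    using diagonalises_exists[OF A sym] by blast
  note S = diagonalises_det_nonzero[OF D A] and d = diagonalises_eigenvalue[OF D A]
    and det = diagonalises_det[OF D A] and inv = diagonalises_inverse[OF D A]
  have "det A * (det S)\<^sup>2 > 0" using det[of 1 0] by simp
  then show ?thesis by (simp add: zero_less_mult_iff)
qed

text \<open>
  Strict log-concavity of the determinant. After diagonalisation the eigenvalues \<open>d i\<close> have product
  one, and each satisfies \<open>((1 + d i) / 2)\<^sup>2 \<ge> d i\<close> with equality only for \<open>d i = 1\<close>; a product of the
  left-hand sides of at most one therefore leaves no room for a strict inequality.
\<close>
lemma det_midpoint_eq:
  fixes A B :: "real ^ 'p ^ 'p"
  assumes A: "pos_def A" and B: "transpose B = B" "\<And>v. 0 \<le> v \<bullet> (B *v v)"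
    and eq: "det B = det A" and le: "det ((1/2) *\<^sub>R A + (1/2) *\<^sub>R B) \<le> det A"
  shows "B = A"
proof -
  obtain S d where D: "diagonalises S A B d"
    using diagonalises_exists[OF A B(1)] by blast
  note S = diagonalises_det_nonzero[OF D A] and d = diagonalises_eigenvalue[OF D A]
    and det = diagonalises_det[OF D A] and inv = diagonalises_inverse[OF D A]
  have d0: "d i \<ge> 0" for i by (simp add: d B(2))
  have detA: "det A * (det S)\<^sup>2 = 1" using det[of 1 0] by simp
  have prod_d: "(\<Prod>i\<in>UNIV. d i) = 1" using det[of 0 1] eq detA by simp
  have dpos: "d i > 0" for i
    using prod_d d0[of i] by (metis UNIV_I finite less_eq_real_def prod_zero_iff zero_neq_one)
  have "(\<Prod>i\<in>UNIV. 1/2 + (1/2) * d i) \<le> 1"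
    using mult_right_mono[OF le, of "(det S)\<^sup>2"] by (simp only: det detA) simp
  moreover have "(\<Prod>i\<in>UNIV. 1/2 + (1/2) * d i) \<ge> 0" 
    using d0 by (intro prod_nonneg) auto
  ultimately have mid: "(\<Prod>i\<in>UNIV. (1/2 + (1/2) * d i)\<^sup>2) \<le> 1"
    by (simp add: power_le_one flip: prod_power_distrib)
  have amgm: "(1/2 + (1/2) * x)\<^sup>2 - x = ((1 - x) / 2)\<^sup>2" for x :: real
    by (simp add: power2_eq_square field_simps)
  have "d k = 1" for k
  proof (rule ccontr)
    assume "d k \<noteq> 1"
    then have "((1 - d k) / 2)\<^sup>2 > 0" by simp
    then have "d k < (1/2 + (1/2) * d k)\<^sup>2" using amgm[of "d k"] by linarith
    moreover have "d i \<le> (1/2 + (1/2) * d i)\<^sup>2" for i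
      using amgm[of "d i"] zero_le_power2[of "(1 - d i) / 2"] by linarith
    moreover have "0 < (1/2 + (1/2) * d i)\<^sup>2" for i
      using dpos[of i] by (intro zero_less_power) simp
    ultimately have "(\<Prod>i\<in>UNIV. d i) < (\<Prod>i\<in>UNIV. (1/2 + (1/2) * d i)\<^sup>2)"
      using d0 by (intro prod_mono_strict[where i = k and A = UNIV, OF UNIV_I _ finite]) blast+
    then show False using mid prod_d by simp
  qed
  then show ?thesis by (rule diagonalises_eq[OF D A])
qed

text \<open>
  A common form for the information matrix of a design, indexed by its support, and for that of an
  empirical design, indexed by time so that repeated points need no bookkeeping.
\<close>
definition weighted_gram :: "'k set \<Rightarrow> ('k \<Rightarrow> real) \<Rightarrow> ('k \<Rightarrow> real ^ 'p) \<Rightarrow> real ^ 'p ^ 'p"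
  where "weighted_gram K w g = (\<Sum>k\<in>K. w k *\<^sub>R outer (g k))"

lemma outer_mult_vec: "outer a *v v = (a \<bullet> v) *\<^sub>R a"
  by (simp add: vec_eq_iff outer_def matrix_vector_mult_def inner_vec_def sum_distrib_left mult_ac)

lemma weighted_gram_mult_vec:
  "weighted_gram K w g *v v = (\<Sum>k\<in>K. (w k * (g k \<bullet> v)) *\<^sub>R g k)"
proof (cases "finite K")
  case True
  then show ?thesis
    unfolding weighted_gram_def
    by (induction K) (simp_all add: matrix_vector_mult_add_rdistrib outer_mult_vec
        scaleR_matrix_vector_assoc[symmetric])
qed (simp add: weighted_gram_def)

lemma weighted_gram_form:
  "u \<bullet> (weighted_gram K w g *v v) = (\<Sum>k\<in>K. w k * (g k \<bullet> u) * (g k \<bullet> v))"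
  by (simp add: weighted_gram_mult_vec inner_sum_right mult_ac inner_commute)

lemma weighted_gram_quadratic:
  "v \<bullet> (weighted_gram K w g *v v) = (\<Sum>k\<in>K. w k * (g k \<bullet> v)\<^sup>2)"
  by (simp add: weighted_gram_form power2_eq_square mult_ac)

lemma transpose_weighted_gram: "transpose (weighted_gram K w g) = weighted_gram K w g"
  by (simp add: weighted_gram_def vec_eq_iff transpose_def outer_def mult_ac)

text \<open>
  The tangent inequality of the concave function \<open>ln det\<close> at \<open>A\<close>, in exponential form: the sum is
  the trace of \<open>A\<^sup>-\<^sup>1 B\<close>, hence the sum of the eigenvalues \<open>d i\<close>, and each \<open>d i\<close> is at most
  \<open>exp (d i - 1)\<close>.
\<close>
lemma det_weighted_gram_le:
  fixes A :: "real ^ 'p ^ 'p"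
  assumes A: "pos_def A" and w: "\<And>k. k \<in> K \<Longrightarrow> 0 \<le> w k"
  shows "det (weighted_gram K w g)
    \<le> det A * exp ((\<Sum>k\<in>K. w k * (g k \<bullet> (matrix_inv A *v g k))) - real CARD('p))"
proof -
  define B where "B = weighted_gram K w g"
  have symB: "transpose B = B" by (simp add: B_def transpose_weighted_gram)
  obtain S d where D: "diagonalises S A B d"
    using diagonalises_exists[OF A symB] by blast
  note S = diagonalises_det_nonzero[OF D A] and d = diagonalises_eigenvalue[OF D A]
    and det = diagonalises_det[OF D A] and inv = diagonalises_inverse[OF D A]
  have d': "d i = (\<Sum>k\<in>K. w k * (column i S \<bullet> g k)\<^sup>2)" for i
    by (simp add: d B_def weighted_gram_quadratic inner_commute)
  then have d0: "d i \<ge> 0" for i by (simp add: sum_nonneg w)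
  have "(\<Sum>i\<in>UNIV. d i) = (\<Sum>k\<in>K. \<Sum>i\<in>UNIV. w k * (column i S \<bullet> g k)\<^sup>2)"
    unfolding d' by (rule sum.swap)
  also have "\<dots> = (\<Sum>k\<in>K. w k * (g k \<bullet> (matrix_inv A *v g k)))"
    by (simp add: inv flip: sum_distrib_left)
  finally have sum_d: "(\<Sum>i\<in>UNIV. d i) = \<dots>" .
  have detA: "det A * (det S)\<^sup>2 = 1" using det[of 1 0] by simp
  have "det B * (det S)\<^sup>2 = (\<Prod>i\<in>UNIV. d i)" using det[of 0 1] by simp
  also have "\<dots> \<le> (\<Prod>i\<in>UNIV. exp (d i - 1))"
    using d0 exp_ge_add_one_self[of "d _ - 1"] by (intro prod_mono) auto
  also have "\<dots> = exp ((\<Sum>i\<in>UNIV. d i) - real CARD('p))"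
    by (simp add: sum_subtractf flip: exp_sum)
  also have "\<dots> = (det A * exp ((\<Sum>i\<in>UNIV. d i) - real CARD('p))) * (det S)\<^sup>2"
    using detA by (simp add: mult_ac)
  finally show ?thesis using S by (simp add: sum_d B_def)
qed

lemma one_plus_sum_le_prod:
  fixes x :: "'i \<Rightarrow> real"
  assumes "finite I" "\<And>i. i \<in> I \<Longrightarrow> 0 \<le> x i"
  shows "1 + (\<Sum>i\<in>I. x i) \<le> (\<Prod>i\<in>I. 1 + x i)"
  using assms
proof (induction I)
  case (insert j I)
  have "1 + (\<Sum>i\<in>insert j I. x i) \<le> (1 + x j) * (1 + (\<Sum>i\<in>I. x i))"
    using insert by (simp add: algebra_simps sum_nonneg)
  also have "\<dots> \<le> (1 + x j) * (\<Prod>i\<in>I. 1 + x i)"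
    using insert by (intro mult_left_mono) auto
  finally show ?case using insert by simp
qed simp

text \<open>
  One half of the matrix determinant lemma: expanding the product of the factors \<open>1 + t * d i\<close> leaves
  nonnegative terms beyond the constant and the linear one.
\<close>
lemma det_rank_one_update_ge:
  fixes A :: "real ^ 'p ^ 'p"
  assumes A: "pos_def A" and "t \<ge> 0"
  shows "det A * (1 + t * (g \<bullet> (matrix_inv A *v g))) \<le> det (A + t *\<^sub>R outer g)"
proof -
  have sym: "transpose (outer g) = outer g"
    by (simp add: vec_eq_iff transpose_def outer_def mult_ac)
  obtain S d where D: "diagonalises S A (outer g) d"
    using diagonalises_exists[OF A sym] by blast
  note S = diagonalises_det_nonzero[OF D A] and d = diagonalises_eigenvalue[OF D A]
    and det = diagonalises_det[OF D A] and inv = diagonalises_inverse[OF D A]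
  have d': "d i = (column i S \<bullet> g)\<^sup>2" for i
    by (simp add: d outer_mult_vec power2_eq_square inner_commute)
  have detA: "det A * (det S)\<^sup>2 = 1" using det[of 1 0] by simp
  have "(det A * (1 + t * (g \<bullet> (matrix_inv A *v g)))) * (det S)\<^sup>2 = 1 + (\<Sum>i\<in>UNIV. t * d i)"
    using detA by (simp add: inv d' mult_ac flip: sum_distrib_left)
  also have "\<dots> \<le> (\<Prod>i\<in>UNIV. 1 + t * d i)"
    using \<open>t \<ge> 0\<close> by (intro one_plus_sum_le_prod) (auto simp: d')
  also have "\<dots> = det (A + t *\<^sub>R outer g) * (det S)\<^sup>2"
    using det[of 1 t] by simp
  finally show ?thesis using S by simp
qed

lemma det_scaleR:
  fixes A :: "real ^ 'p ^ 'p"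
  shows "det (c *\<^sub>R A) = c ^ CARD('p) * det A"
proof -
  have "c *\<^sub>R A = (\<chi> i. c *s (A $ i))"
    by (simp add: vec_eq_iff)
  then show ?thesis using det_rows_mul[of "\<lambda>_. c" "\<lambda>i. A $ i"] by simp
qed

lemma continuous_on_det: "continuous_on S (det :: real ^ 'p ^ 'p \<Rightarrow> real)"
  unfolding det_def by (intro continuous_intros)

text \<open>
  By strict log-concavity, \<open>B\<close> is the only matrix with determinant \<open>det B\<close> among those that satisfy the
  conditions imposed on \<open>A n\<close>. These conditions describe a compact set, so off any ball around \<open>B\<close> the
  determinant keeps a positive distance from \<open>det B\<close>.
\<close>
lemma tendsto_if_det_tendsto:
  fixes A :: "nat \<Rightarrow> real ^ 'p ^ 'p" and B :: "real ^ 'p ^ 'p"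
  assumes \<alpha>: "\<alpha> > 0"
    and B: "transpose B = B" "\<And>v. 0 \<le> v \<bullet> (B *v v)"
    and A: "\<forall>\<^sub>F n in sequentially. norm (A n) \<le> R \<and> transpose (A n) = A n
      \<and> (\<forall>v. \<alpha> * (norm v)\<^sup>2 \<le> v \<bullet> (A n *v v))
      \<and> det ((1/2) *\<^sub>R A n + (1/2) *\<^sub>R B) \<le> det B"
    and det_lim: "(\<lambda>n. det (A n)) \<longlonglongrightarrow> det B"
  shows "A \<longlonglongrightarrow> B"
proof (rule tendstoI)
  fix e :: real assume "e > 0"
  define S where "S = {C :: real ^ 'p ^ 'p. norm C \<le> R \<and> transpose C = C
    \<and> (\<forall>v. \<alpha> * (norm v)\<^sup>2 \<le> v \<bullet> (C *v v))
    \<and> det ((1/2) *\<^sub>R C + (1/2) *\<^sub>R B) \<le> det B \<and> e \<le> dist C B}"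
  have "closed S"
    unfolding S_def transpose_def matrix_vector_mult_def
    by (intro closed_Collect_conj closed_Collect_all closed_Collect_le closed_Collect_eq
        continuous_on_compose2[OF continuous_on_det[of UNIV]] continuous_intros) auto
  moreover have "bounded S" by (rule boundedI[of _ R]) (auto simp: S_def)
  ultimately have "compact S" by (simp add: compact_eq_bounded_closed)
  have ne: "det C \<noteq> det B" if "C \<in> S" for C
  proof
    assume eq: "det C = det B"
    have pd: "pos_def C" unfolding pos_def_def
      using that \<alpha> by (auto simp: S_def intro: less_le_trans[rotated])
    have "B = C"
      by (rule det_midpoint_eq[OF pd B]) (use eq that in \<open>auto simp: S_def\<close>)
    then show False using that \<open>e > 0\<close> by (simp add: S_def)
  qed
  obtain \<delta> where \<delta>: "\<delta> > 0" "\<And>C. C \<in> S \<Longrightarrow> \<delta> \<le> \<bar>det C - det B\<bar>"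
  proof (cases "S = {}")
    case False
    have "continuous_on S (\<lambda>C. \<bar>det C - det B\<bar>)"
      by (intro continuous_intros continuous_on_det)
    from continuous_attains_inf[OF \<open>compact S\<close> False this]
    obtain C\<^sub>0 where "C\<^sub>0 \<in> S" "\<forall>C\<in>S. \<bar>det C\<^sub>0 - det B\<bar> \<le> \<bar>det C - det B\<bar>"
      by blast
    then show ?thesis using that[of "\<bar>det C\<^sub>0 - det B\<bar>"] ne[of C\<^sub>0] by auto
  qed (use that[of 1] in auto)
  from tendstoD[OF det_lim \<delta>(1)] A show "\<forall>\<^sub>F n in sequentially. dist (A n) B < e"
  proof eventually_elim
    case (elim n)
    have "A n \<notin> S" using \<delta>(2)[of "A n"] elim(1) by (auto simp: dist_real_def)
    then show ?case using elim(2) by (auto simp: S_def not_le)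
  qed
qed

section \<open>Perturbation bounds\<close>

lemma norm_matrix_vector_mult_le:
  fixes M :: "real ^ 'n ^ 'm"
  shows "norm (M *v v) \<le> norm M * norm v"
proof -
  have "norm (M *v v) \<le> L2_set (\<lambda>i. norm (M $ i) * norm v) UNIV"
    unfolding norm_vec_def[of "M *v v"]
    by (intro L2_set_mono) (simp_all add: matrix_vector_mul_component Cauchy_Schwarz_ineq2)
  also have "\<dots> = norm M * norm v"
    by (simp add: norm_vec_def[of M] L2_set_left_distrib)
  finally show ?thesis .
qed

lemma coercive_perturb:
  fixes A B :: "real ^ 'p ^ 'p"
  assumes "norm (A - B) \<le> b" "a * (norm v)\<^sup>2 \<le> v \<bullet> (A *v v)"
  shows "(a - b) * (norm v)\<^sup>2 \<le> v \<bullet> (B *v v)"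
proof -
  have "\<bar>v \<bullet> ((A - B) *v v)\<bar> \<le> norm v * norm ((A - B) *v v)" by (rule Cauchy_Schwarz_ineq2)
  also have "\<dots> \<le> norm v * (norm (A - B) * norm v)"
    by (intro mult_left_mono norm_matrix_vector_mult_le) auto
  also have "\<dots> \<le> norm v * (b * norm v)"
    by (intro mult_left_mono mult_right_mono assms) auto
  finally have "\<bar>v \<bullet> (A *v v) - v \<bullet> (B *v v)\<bar> \<le> b * (norm v)\<^sup>2"
    by (simp add: matrix_vector_mult_diff_rdistrib inner_diff_right power2_eq_square mult_ac)
  then show ?thesis using assms(2) by (simp add: algebra_simps abs_le_iff)
qed

lemma norm_inverse_le:
  fixes A :: "real ^ 'p ^ 'p"
  assumes A: "pos_def A" and "\<alpha> > 0" and coercive: "\<And>v. \<alpha> * (norm v)\<^sup>2 \<le> v \<bullet> (A *v v)"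
  shows "norm (matrix_inv A *v v) \<le> norm v / \<alpha>"
proof -
  define u where "u = matrix_inv A *v v"
  have "\<alpha> * norm u * norm u \<le> norm u * norm v"
    using coercive[of u] norm_cauchy_schwarz[of u v]
    by (simp add: u_def pos_def_inv_cancel[OF A] power2_eq_square mult_ac)
  then have "\<alpha> * norm u \<le> norm v"
    by (cases "norm u = 0") (auto simp: mult_ac)
  then show ?thesis using \<open>\<alpha> > 0\<close> by (simp add: field_simps flip: u_def)
qed

text \<open>
  Lipschitz dependence of the sensitivity on the matrix and on the vector, from
  \<open>A\<^sup>-\<^sup>1 - B\<^sup>-\<^sup>1 = A\<^sup>-\<^sup>1 (B - A) B\<^sup>-\<^sup>1\<close>. The constants depend on the matrices only through the common lower
  bound \<open>\<alpha>\<close>, so they are uniform in time once the designs are known not to degenerate.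
\<close>
lemma inverse_form_perturbation:
  fixes A B :: "real ^ 'p ^ 'p"
  assumes A: "pos_def A" and B: "pos_def B" and "\<alpha> > 0"
    and cA: "\<And>v. \<alpha> * (norm v)\<^sup>2 \<le> v \<bullet> (A *v v)"
    and cB: "\<And>v. \<alpha> * (norm v)\<^sup>2 \<le> v \<bullet> (B *v v)"
    and a: "norm a \<le> C" and b: "norm b \<le> C"
  shows "\<bar>a \<bullet> (matrix_inv A *v a) - b \<bullet> (matrix_inv B *v b)\<bar>
    \<le> (C / \<alpha>)\<^sup>2 * norm (A - B) + 2 * (C / \<alpha>) * norm (a - b)"
proof -
  define u where "u = matrix_inv A *v a"
  define w where "w = matrix_inv B *v a"
  define y where "y = matrix_inv B *v b"
  have nu: "norm u \<le> C / \<alpha>" and nw: "norm w \<le> C / \<alpha>" and ny: "norm y \<le> C / \<alpha>"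
    using norm_inverse_le[OF A \<open>\<alpha> > 0\<close> cA, of a] norm_inverse_le[OF B \<open>\<alpha> > 0\<close> cB] a b \<open>\<alpha> > 0\<close>
    unfolding u_def w_def y_def by (meson divide_right_mono less_imp_le order_trans)+
  have C: "C \<ge> 0" using a norm_ge_zero order_trans by blast
  have "a \<bullet> u - a \<bullet> w = (B *v w) \<bullet> u - (A *v u) \<bullet> w"
    by (simp add: u_def w_def pos_def_inv_cancel[OF A] pos_def_inv_cancel[OF B])
  also have "(A *v u) \<bullet> w = (A *v w) \<bullet> u"
    using symmetric_dot[of A u w] A by (simp add: pos_def_def inner_commute)
  finally have 1: "a \<bullet> u - a \<bullet> w = - (((A - B) *v w) \<bullet> u)"
    by (simp add: matrix_vector_mult_diff_rdistrib inner_diff_left)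
  have "\<bar>((A - B) *v w) \<bullet> u\<bar> \<le> norm ((A - B) *v w) * norm u"
    by (rule Cauchy_Schwarz_ineq2)
  also have "\<dots> \<le> (norm (A - B) * norm w) * norm u"
    by (intro mult_right_mono norm_matrix_vector_mult_le) auto
  also have "\<dots> \<le> (norm (A - B) * (C / \<alpha>)) * (C / \<alpha>)"
    using nu nw C \<open>\<alpha> > 0\<close> by (intro mult_mono) auto
  finally have 2: "\<bar>a \<bullet> u - a \<bullet> w\<bar> \<le> (C / \<alpha>)\<^sup>2 * norm (A - B)"
    using 1 by (simp add: power2_eq_square mult_ac)
  have "a \<bullet> w - b \<bullet> y = (a - b) \<bullet> w + (a - b) \<bullet> y"
    using pos_def_inv_dot[OF B, of a b]
    by (simp add: w_def y_def inner_diff_left inner_commute)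
  then have "\<bar>a \<bullet> w - b \<bullet> y\<bar> \<le> norm (a - b) * norm w + norm (a - b) * norm y"
    using Cauchy_Schwarz_ineq2[of "a - b" w] Cauchy_Schwarz_ineq2[of "a - b" y] by linarith
  also have "\<dots> \<le> norm (a - b) * (C / \<alpha>) + norm (a - b) * (C / \<alpha>)"
    using nw ny by (intro add_mono mult_left_mono) auto
  finally show ?thesis using 2 by (simp flip: u_def w_def y_def)
qed

section \<open>Recurrence of points of high sensitivity\<close>

text \<open>
  Let \<open>u = A\<^sup>-\<^sup>1 h\<close>. The vectors \<open>g i\<close> have mean square \<open>D\<close> along \<open>u\<close>, whereas \<open>h \<bullet> u = D\<close>, so by
  Chebyshev's inequality at most \<open>4 n / D\<close> of them reach \<open>D / 2\<close> along \<open>u\<close>. Those close to \<open>h\<close> do: maximality of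
  \<open>D\<close> over a set \<open>Z\<close> that sees every direction gives \<open>\<kappa> * norm u \<le> D\<close>, so moving by \<open>\<kappa> / 2\<close> changes the value
  along \<open>u\<close> by at most \<open>D / 2\<close>. No eigenvalue of \<open>A\<close> enters, which is what makes the statement
  usable while \<open>A\<close> may still be close to singular.
\<close>
lemma few_points_near_direction:
  fixes A :: "real ^ 'p ^ 'p" and h :: "real ^ 'p"
  defines "D \<equiv> h \<bullet> (matrix_inv A *v h)"
  assumes A_eq: "A = weighted_gram {1..n} (\<lambda>_. 1 / real n) g" and A: "pos_def A" and n: "n \<ge> 1"
    and \<kappa>: "\<kappa> > 0" and spread: "\<And>v. \<exists>z\<in>Z. \<kappa> * norm v \<le> \<bar>z \<bullet> v\<bar>"
    and max: "\<And>z. z \<in> Z \<Longrightarrow> z \<bullet> (matrix_inv A *v z) \<le> D"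
  shows "real (card {i\<in>{1..n}. norm (g i - h) \<le> \<kappa> / 2}) * D \<le> 4 * real n"
proof -
  define u where "u = matrix_inv A *v h"
  define T where "T = {i\<in>{1..n}. norm (g i - h) \<le> \<kappa> / 2}"
  have D0: "D \<ge> 0" unfolding D_def by (rule pos_def_inv_nonneg[OF A])
  have hu: "h \<bullet> u = D" by (simp add: D_def u_def)
  have "\<kappa> * norm u \<le> D"
  proof -
    obtain z where z: "z \<in> Z" "\<kappa> * norm u \<le> \<bar>z \<bullet> u\<bar>" using spread by blast
    have "(z \<bullet> u)\<^sup>2 \<le> (z \<bullet> (matrix_inv A *v z)) * D"
      unfolding u_def D_def by (rule pos_def_inv_Cauchy_Schwarz(1)[OF A])
    also have "\<dots> \<le> D * D" using max[OF z(1)] D0 by (intro mult_right_mono)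
    finally have "\<bar>z \<bullet> u\<bar> \<le> D"
      using D0 abs_le_square_iff[of "z \<bullet> u" D] by (simp add: power2_eq_square)
    then show ?thesis using z(2) by simp
  qed
  have near: "(D / 2)\<^sup>2 \<le> (g i \<bullet> u)\<^sup>2" if "i \<in> T" for i
  proof -
    have "\<bar>(g i - h) \<bullet> u\<bar> \<le> norm (g i - h) * norm u" by (rule Cauchy_Schwarz_ineq2)
    also have "\<dots> \<le> \<kappa> / 2 * norm u" using that by (intro mult_right_mono) (auto simp: T_def)
    finally have "\<bar>(g i - h) \<bullet> u\<bar> \<le> D / 2" using \<open>\<kappa> * norm u \<le> D\<close> by simp
    then have "D / 2 \<le> g i \<bullet> u" unfolding inner_diff_left hu by linarith
    then show ?thesis using D0 by (intro power_mono) auto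
  qed
  have "real (card T) * (D / 2)\<^sup>2 = (\<Sum>i\<in>T. (D / 2)\<^sup>2)" by simp
  also have "\<dots> \<le> (\<Sum>i\<in>T. (g i \<bullet> u)\<^sup>2)" by (intro sum_mono near)
  also have "\<dots> \<le> (\<Sum>i=1..n. (g i \<bullet> u)\<^sup>2)" by (intro sum_mono2) (auto simp: T_def)
  also have "\<dots> = real n * (u \<bullet> (A *v u))"
    using n by (simp add: A_eq weighted_gram_quadratic sum_distrib_left)
  also have "u \<bullet> (A *v u) = D" by (simp add: u_def D_def pos_def_inv_cancel[OF A] inner_commute)
  finally have *: "real (card T) * (D / 2)\<^sup>2 \<le> real n * D" .
  show ?thesis
  proof (cases "D = 0")
    case False
    then have "D > 0" using D0 by simp
    have "(real (card T) * D) * D \<le> (4 * real n) * D"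
      using * by (simp add: power2_eq_square field_simps)
    then show ?thesis using \<open>D > 0\<close> by (simp add: T_def)
  qed simp
qed

text \<open>
  Among the times in \<open>{m<..2*m}\<close> that carry a given colour, the last one is preceded by all the
  others, of which there are at most \<open>q\<close>. Hence no colour occurs more than \<open>q + 1\<close> times.
\<close>
lemma colour_count:
  fixes c :: "nat \<Rightarrow> 'c" and q :: real
  assumes "finite K" and col: "\<And>n. m \<le> n \<Longrightarrow> n < 2 * m \<Longrightarrow> c (Suc n) \<in> K"
    and few: "\<And>n. m \<le> n \<Longrightarrow> n < 2 * m \<Longrightarrow> real (card {i\<in>{1..n}. c i = c (Suc n)}) \<le> q"
    and "q \<ge> 0"
  shows "real m \<le> real (card K) * (q + 1)"
proof -
  define J where "J k = {i\<in>{m<..2*m}. c i = k}" for k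
  have "{m<..2*m} = (\<Union>k\<in>K. J k)"
  proof -
    have "c i \<in> K" if "i \<in> {m<..2*m}" for i
      using col[of "i - 1"] that by (cases i) auto
    then show ?thesis by (auto simp: J_def)
  qed
  then have "card {m<..2*m} \<le> (\<Sum>k\<in>K. card (J k))"
    using card_UN_le[OF \<open>finite K\<close>] by metis
  then have "real m \<le> (\<Sum>k\<in>K. real (card (J k)))"
    by (simp flip: of_nat_sum)
  also have "\<dots> \<le> (\<Sum>k\<in>K. q + 1)"
  proof (intro sum_mono)
    fix k
    show "real (card (J k)) \<le> q + 1"
    proof (cases "J k = {}")
      case False
      have fin: "finite (J k)" by (simp add: J_def)
      define j where "j = Max (J k)"
      have j: "j \<in> J k" using False fin by (simp add: j_def)
      have le: "i \<le> j" if "i \<in> J k" for i using that fin by (simp add: j_def)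
      obtain n where n: "j = Suc n" using j by (cases j) (auto simp: J_def)
      have "J k - {j} \<subseteq> {i\<in>{1..n}. c i = c (Suc n)}"
        using le j by (force simp: J_def n)
      then have "card (J k - {j}) \<le> card {i\<in>{1..n}. c i = c (Suc n)}"
        by (intro card_mono) auto
      also have "real \<dots> \<le> q" using j by (intro few) (auto simp: J_def n)
      finally have "real (card (J k - {j})) \<le> q" by simp
      then show ?thesis using j fin by (simp add: card_Diff_singleton_if card_gt_0_iff of_nat_diff)
    qed (use \<open>q \<ge> 0\<close> in simp)
  qed
  also have "\<dots> = real (card K) * (q + 1)" by simp
  finally show ?thesis .
qed

section \<open>A relaxation recursion\<close>

text \<open>
  The recursion with error \<open>e\<close> says exactly that \<open>(n - 1) (\<Delta> n - e)\<close> does not increase with \<open>n\<close>, so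
  \<open>\<Delta> n\<close> exceeds \<open>e\<close> by \<open>O(1/n)\<close> at most.
\<close>
lemma relaxation_tendsto_zero:
  fixes \<Delta> :: "nat \<Rightarrow> real"
  assumes nonneg: "\<forall>\<^sub>F n in sequentially. 0 \<le> \<Delta> n"
    and step: "\<And>e. e > 0 \<Longrightarrow> \<forall>\<^sub>F n in sequentially. \<Delta> (Suc n) \<le> \<Delta> n + (e - \<Delta> n) / real n"
  shows "\<Delta> \<longlonglongrightarrow> 0"
proof (rule tendstoI)
  fix e :: real assume "e > 0"
  obtain N where N: "\<And>n. n \<ge> N \<Longrightarrow> \<Delta> (Suc n) \<le> \<Delta> n + (e / 2 - \<Delta> n) / real n"
    using step[of "e / 2"] \<open>e > 0\<close> by (auto simp: eventually_sequentially)
  define N' where "N' = Suc N"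
  define E where "E n = (real n - 1) * (\<Delta> n - e / 2)" for n
  have E: "E n \<le> E N'" if "n \<ge> N'" for n
    using that
  proof (induction n rule: dec_induct)
    case (step n)
    have "real n * (\<Delta> (Suc n) - e / 2) \<le> real n * (\<Delta> n + (e / 2 - \<Delta> n) / real n - e / 2)"
      using N[of n] step by (intro mult_left_mono) (auto simp: N'_def)
    also have "\<dots> = E n" using step by (simp add: E_def N'_def field_simps)
    finally show ?case using step by (simp add: E_def)
  qed simp
  have "(\<lambda>n. E N' / (real n - 1)) \<longlonglongrightarrow> 0"
    by real_asymp
  then have "\<forall>\<^sub>F n in sequentially. dist (E N' / (real n - 1)) 0 < e / 2"
    using \<open>e > 0\<close> by (intro tendstoD) auto
  with nonneg eventually_ge_at_top[of "max 2 N'"]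
  show "\<forall>\<^sub>F n in sequentially. dist (\<Delta> n) 0 < e"
  proof eventually_elim
    case (elim n)
    have "\<Delta> n - e / 2 = E n / (real n - 1)" using elim by (simp add: E_def)
    also have "\<dots> \<le> E N' / (real n - 1)" using elim E[of n] by (intro divide_right_mono) auto
    also have "\<dots> \<le> \<bar>E N' / (real n - 1)\<bar>" by (rule abs_ge_self)
    also have "\<dots> < e / 2" using elim by simp
    finally show ?case using elim by simp
  qed
qed

section \<open>Information matrices of designs\<close>

lemma info_eq_weighted_gram: "info f \<xi> \<theta> = weighted_gram (set_pmf \<xi>) (pmf \<xi>) (f \<theta>)"
  by (simp add: info_def weighted_gram_def)

lemma info_superset:
  assumes "finite F" "set_pmf \<xi> \<subseteq> F"
  shows "info f \<xi> \<theta> = (\<Sum>z\<in>F. pmf \<xi> z *\<^sub>R outer (f \<theta> z))"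
  unfolding info_def
  by (rule sum.mono_neutral_left) (use assms in \<open>auto simp: set_pmf_iff\<close>)

lemma set_empirical_design: "n \<ge> 1 \<Longrightarrow> set_pmf (empirical_design n x) = x ` {1..n}"
  by (auto simp: empirical_design_def)

lemma design_empirical:
  assumes "n \<ge> 1" "\<And>i. i \<ge> 1 \<Longrightarrow> x i \<in> XX"
  shows "design XX (empirical_design n x)"
  using assms by (auto simp: design_def set_empirical_design)

lemma info_empirical_design:
  assumes "n \<ge> 1"
  shows "info f (empirical_design n x) \<theta> = weighted_gram {1..n} (\<lambda>_. 1 / real n) (\<lambda>i. f \<theta> (x i))"
proof -
  have "info f (empirical_design n x) \<theta>
      = (\<Sum>z\<in>x ` {1..n}. \<Sum>i=1..n. (pmf (return_pmf (x i)) z / real n) *\<^sub>R outer (f \<theta> z))"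
    using assms by (simp add: info_def set_empirical_design pmf_empirical_design sum_divide_distrib
        scaleR_sum_left)
  also have "\<dots> = (\<Sum>i=1..n. \<Sum>z\<in>x ` {1..n}. (pmf (return_pmf (x i)) z / real n) *\<^sub>R outer (f \<theta> z))"
    by (rule sum.swap)
  also have "\<dots> = (\<Sum>i=1..n. (1 / real n) *\<^sub>R outer (f \<theta> (x i)))"
  proof (rule sum.cong)
    fix i assume "i \<in> {1..n}"
    then have "(\<Sum>z\<in>x ` {1..n}. (pmf (return_pmf (x i)) z / real n) *\<^sub>R outer (f \<theta> z))
      = (\<Sum>z\<in>{x i}. (pmf (return_pmf (x i)) z / real n) *\<^sub>R outer (f \<theta> z))"
      by (intro sum.mono_neutral_right) (auto simp: indicator_def)
    then show "(\<Sum>z\<in>x ` {1..n}. (pmf (return_pmf (x i)) z / real n) *\<^sub>R outer (f \<theta> z))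
      = (1 / real n) *\<^sub>R outer (f \<theta> (x i))" by simp
  qed simp
  finally show ?thesis by (simp add: weighted_gram_def)
qed

text \<open>
  Information matrices form a convex set. The weights are \<open>1/2\<close> because strict log-concavity enters in
  its midpoint form.
\<close>
lemma design_midpoint:
  assumes "design XX \<xi>" "design XX \<eta>"
  shows "\<exists>\<zeta>. design XX \<zeta> \<and> info f \<zeta> \<theta> = (1/2) *\<^sub>R info f \<xi> \<theta> + (1/2) *\<^sub>R info f \<eta> \<theta>"
proof -
  define \<zeta> where "\<zeta> = bind_pmf (bernoulli_pmf (1/2)) (\<lambda>b. if b then \<xi> else \<eta>)"
  have set: "set_pmf \<zeta> = set_pmf \<xi> \<union> set_pmf \<eta>"
    by (auto simp: \<zeta>_def UNIV_bool)
  have pmf: "pmf \<zeta> z = (1/2) * pmf \<xi> z + (1/2) * pmf \<eta> z" for z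
    by (simp add: \<zeta>_def pmf_bind)
  define F where "F = set_pmf \<xi> \<union> set_pmf \<eta>"
  have fin: "finite F" using assms by (simp add: design_def F_def)
  show ?thesis
  proof (intro exI conjI)
    show "design XX \<zeta>" using assms by (auto simp: design_def set)
    show "info f \<zeta> \<theta> = (1/2) *\<^sub>R info f \<xi> \<theta> + (1/2) *\<^sub>R info f \<eta> \<theta>"
      by (simp add: info_superset[OF fin] F_def set pmf scaleR_add_left sum.distrib scaleR_sum_right)
  qed
qed

lemma continuous_on_outer: "continuous_on S outer"
  unfolding outer_def by (intro continuous_intros)

lemma eventually_uniformly_close:
  fixes h :: "'t::metric_space \<Rightarrow> 'x::metric_space \<Rightarrow> 'v::metric_space"
  assumes "compact XX" "compact \<Theta>" and cont: "continuous_on (XX \<times> \<Theta>) (\<lambda>(z, \<theta>). h \<theta> z)"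
    and "\<theta>bar \<in> \<Theta>" and mem: "\<forall>\<^sub>F n in sequentially. t n \<in> \<Theta>" and lim: "t \<longlonglongrightarrow> \<theta>bar" and "e > 0"
  shows "\<forall>\<^sub>F n in sequentially. \<forall>z\<in>XX. dist (h (t n) z) (h \<theta>bar z) < e"
proof -
  have "uniformly_continuous_on (XX \<times> \<Theta>) (\<lambda>(z, \<theta>). h \<theta> z)"
    by (intro compact_uniformly_continuous cont compact_Times assms)
  from uniformly_continuous_onE[OF this \<open>e > 0\<close>] obtain d where "d > 0"
    and d: "\<And>p p'. p \<in> XX \<times> \<Theta> \<Longrightarrow> p' \<in> XX \<times> \<Theta> \<Longrightarrow> dist p' p < d \<Longrightarrow>
      dist (case p' of (z, \<theta>) \<Rightarrow> h \<theta> z) (case p of (z, \<theta>) \<Rightarrow> h \<theta> z) < e"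
    by blast
  from mem tendstoD[OF lim \<open>d > 0\<close>] show ?thesis
  proof eventually_elim
    case (elim n)
    show ?case
    proof
      fix z assume "z \<in> XX"
      then show "dist (h (t n) z) (h \<theta>bar z) < e"
        using d[of "(z, \<theta>bar)" "(z, t n)"] elim \<open>\<theta>bar \<in> \<Theta>\<close> by (simp add: dist_Pair_Pair)
    qed
  qed
qed

section \<open>Nondegeneracy of the designs along a path\<close>

text \<open>
  One path of the algorithm, with \<open>th\<close> the path of estimates. Estimates start at index \<open>nst\<close> and design
  points at index \<open>1\<close>, hence the guards.
\<close>
locale convergent_wynn_path =
  fixes XX :: "'x::metric_space set" and \<Theta> :: "'t::metric_space set"
    and f :: "'t \<Rightarrow> 'x \<Rightarrow> real ^ 'p" and nst :: nat and th :: "nat \<Rightarrow> 't" and x :: "nat \<Rightarrow> 'x"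
    and \<theta>bar :: 't
  assumes compact_XX: "compact XX" and compact_\<Theta>: "compact \<Theta>" and \<theta>bar: "\<theta>bar \<in> \<Theta>"
    and regression: "regression_family XX \<Theta> f" and nst: "nst \<ge> 1"
    and path: "adaptive_wynn_path XX \<Theta> f nst th x"
    and x_in: "\<And>i. i \<ge> 1 \<Longrightarrow> x i \<in> XX"
    and th_in: "\<And>n. n \<ge> nst \<Longrightarrow> th n \<in> \<Theta>"
    and th_lim: "th \<longlonglongrightarrow> \<theta>bar"
begin

definition M :: "nat \<Rightarrow> 't \<Rightarrow> real ^ 'p ^ 'p"
  where "M n \<theta> = info f (empirical_design n x) \<theta>"

definition sensitivity :: "nat \<Rightarrow> 't \<Rightarrow> 'x \<Rightarrow> real"
  where "sensitivity n \<theta> z = f \<theta> z \<bullet> (matrix_inv (M n \<theta>) *v f \<theta> z)"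

lemma M_eq: "n \<ge> 1 \<Longrightarrow> M n \<theta> = weighted_gram {1..n} (\<lambda>_. 1 / real n) (\<lambda>i. f \<theta> (x i))"
  by (simp add: M_def info_empirical_design)

lemma M_quadratic: "n \<ge> 1 \<Longrightarrow> real n * (v \<bullet> (M n \<theta> *v v)) = (\<Sum>i=1..n. (f \<theta> (x i) \<bullet> v)\<^sup>2)"
  by (simp add: M_eq weighted_gram_quadratic sum_distrib_left)

text \<open>
  The unnormalised matrices \<open>n M\<^sub>n\<close> only gain rank-one terms. This preserves positive definiteness and
  carries lower bounds from one time to later ones.
\<close>
lemma M_mono:
  assumes "1 \<le> m" "m \<le> n"
  shows "real m * (v \<bullet> (M m \<theta> *v v)) \<le> real n * (v \<bullet> (M n \<theta> *v v))"
  using assms by (simp add: M_quadratic) (intro sum_mono2, auto)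

lemma M_pos_def:
  assumes "n \<ge> nst" "\<theta> \<in> \<Theta>"
  shows "pos_def (M n \<theta>)"
  unfolding pos_def_def
proof (intro conjI allI impI)
  have n: "n \<ge> 1" using assms nst by simp
  show "transpose (M n \<theta>) = M n \<theta>"
    by (simp add: M_eq[OF n] transpose_weighted_gram)
  fix v :: "real ^ 'p" assume "v \<noteq> 0"
  then have "0 < v \<bullet> (M nst \<theta> *v v)"
    using path assms by (simp add: adaptive_wynn_path_def M_def pos_def_def)
  then have "0 < real nst * (v \<bullet> (M nst \<theta> *v v))" using nst by simp
  also have "\<dots> \<le> real n * (v \<bullet> (M n \<theta> *v v))" by (intro M_mono nst assms)
  finally show "0 < v \<bullet> (M n \<theta> *v v)" by (simp add: zero_less_mult_iff)
qed

lemma x_max: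
  assumes "n \<ge> nst" "z \<in> XX"
  shows "sensitivity n (th n) z \<le> sensitivity n (th n) (x (Suc n))"
  using path assms by (simp add: adaptive_wynn_path_def is_arg_max_linorder sensitivity_def M_def)

lemma f_bounded:
  obtains C where "C > 0" "\<And>z \<theta>. z \<in> XX \<Longrightarrow> \<theta> \<in> \<Theta> \<Longrightarrow> norm (f \<theta> z) \<le> C"
proof -
  have "compact ((\<lambda>(z, \<theta>). f \<theta> z) ` (XX \<times> \<Theta>))"
    using regression compact_XX compact_\<Theta>
    by (intro compact_continuous_image compact_Times) (auto simp: regression_family_def)
  then have "bounded ((\<lambda>(z, \<theta>). f \<theta> z) ` (XX \<times> \<Theta>))" by (rule compact_imp_bounded)
  then obtain C where "C > 0" and "\<forall>y\<in>(\<lambda>(z, \<theta>). f \<theta> z) ` (XX \<times> \<Theta>). norm y \<le> C"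
    using bounded_pos by metis
  then show ?thesis by (intro that[of C]) auto
qed

lemma f_close:
  assumes "\<forall>\<^sub>F n in sequentially. t n \<in> \<Theta>" "t \<longlonglongrightarrow> \<theta>bar" "e > 0"
  shows "\<forall>\<^sub>F n in sequentially. \<forall>z\<in>XX. norm (f (t n) z - f \<theta>bar z) < e"
  using eventually_uniformly_close[where h = f, OF compact_XX compact_\<Theta> _ \<theta>bar assms] regression
  by (simp add: regression_family_def dist_norm)

lemma M_close:
  assumes "\<forall>\<^sub>F n in sequentially. t n \<in> \<Theta>" "t \<longlonglongrightarrow> \<theta>bar"
  shows "(\<lambda>n. M n (t n) - M n \<theta>bar) \<longlonglongrightarrow> 0"
proof (rule tendstoI)
  fix e :: real assume "e > 0"
  have "continuous_on (XX \<times> \<Theta>) (\<lambda>p. outer (case p of (z, \<theta>) \<Rightarrow> f \<theta> z))"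
    using regression unfolding regression_family_def
    by (intro continuous_on_compose2[OF continuous_on_outer[of UNIV]]) auto
  then have "continuous_on (XX \<times> \<Theta>) (\<lambda>(z, \<theta>). outer (f \<theta> z))"
    by (simp add: case_prod_unfold)
  from eventually_uniformly_close[OF compact_XX compact_\<Theta> this \<theta>bar assms, of "e / 2"] \<open>e > 0\<close>
  have "\<forall>\<^sub>F n in sequentially. \<forall>z\<in>XX. norm (outer (f (t n) z) - outer (f \<theta>bar z)) < e / 2"
    by (simp add: dist_norm)
  then show "\<forall>\<^sub>F n in sequentially. dist (M n (t n) - M n \<theta>bar) 0 < e"
    using eventually_ge_at_top[of 1]
  proof eventually_elim
    case (elim n)
    have "M n (t n) - M n \<theta>bar = (1 / real n) *\<^sub>R (\<Sum>i=1..n. outer (f (t n) (x i)) - outer (f \<theta>bar (x i)))"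
      using elim by (simp add: M_eq weighted_gram_def sum_subtractf scaleR_diff_right scaleR_sum_right)
    also have "norm \<dots> \<le> (1 / real n) * (real (card {1..n}) * (e / 2))"
      unfolding norm_scaleR using elim x_in
      by (intro mult_mono sum_norm_bound) (auto intro!: less_imp_le)
    also have "\<dots> = e / 2" using elim by simp
    finally show ?case using \<open>e > 0\<close> by simp
  qed
qed

lemma th_eventually: "\<forall>\<^sub>F n in sequentially. th n \<in> \<Theta>"
  using eventually_ge_at_top[of nst] by eventually_elim (rule th_in)

text \<open>
  The regression vectors see every direction uniformly. A quadratic form that is an average of
  squares over the starting points is dominated by the largest of these squares, so the
  constant can be read off from positive definiteness of the starting design.
\<close>
lemma spread:
  obtains \<kappa> where "\<kappa> > 0" "\<And>v. \<exists>z\<in>XX. \<kappa> * norm v \<le> \<bar>f \<theta>bar z \<bullet> v\<bar>"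
proof -
  obtain c where c: "c > 0" "\<And>v. c * (norm v)\<^sup>2 \<le> v \<bullet> (M nst \<theta>bar *v v)"
    using pos_def_coercive[OF M_pos_def[OF order_refl \<theta>bar]] by blast
  show ?thesis
  proof (rule that)
    show "sqrt c > 0" using c by simp
    fix v :: "real ^ 'p"
    have "\<exists>i\<in>{1..nst}. c * (norm v)\<^sup>2 \<le> (f \<theta>bar (x i) \<bullet> v)\<^sup>2"
    proof (rule ccontr)
      assume "\<not> ?thesis"
      then have "(\<Sum>i=1..nst. (f \<theta>bar (x i) \<bullet> v)\<^sup>2) < (\<Sum>i=1..nst. c * (norm v)\<^sup>2)"
        using nst by (intro sum_strict_mono) (auto simp: not_le)
      also have "\<dots> = real nst * (c * (norm v)\<^sup>2)" by simp
      also have "\<dots> \<le> real nst * (v \<bullet> (M nst \<theta>bar *v v))"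
        by (intro mult_left_mono c) simp
      also have "\<dots> = (\<Sum>i=1..nst. (f \<theta>bar (x i) \<bullet> v)\<^sup>2)" by (rule M_quadratic[OF nst])
      finally show False by simp
    qed
    then obtain i where i: "i \<ge> 1" "c * (norm v)\<^sup>2 \<le> (f \<theta>bar (x i) \<bullet> v)\<^sup>2" by auto
    have "sqrt c * norm v \<le> \<bar>f \<theta>bar (x i) \<bullet> v\<bar>"
      using real_sqrt_le_mono[OF i(2)] by (simp add: real_sqrt_mult)
    then show "\<exists>z\<in>XX. sqrt c * norm v \<le> \<bar>f \<theta>bar z \<bullet> v\<bar>" using x_in[OF i(1)] by blast
  qed
qed

lemma spread_eventually:
  obtains \<kappa> where "\<kappa> > 0"
    "\<forall>\<^sub>F n in sequentially. \<forall>v. \<exists>z\<in>XX. \<kappa> * norm v \<le> \<bar>f (th n) z \<bullet> v\<bar>"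
proof -
  obtain \<kappa> where \<kappa>: "\<kappa> > 0" "\<And>v. \<exists>z\<in>XX. \<kappa> * norm v \<le> \<bar>f \<theta>bar z \<bullet> v\<bar>"
    using spread by blast
  have "\<kappa> / 2 > 0" using \<kappa>(1) by simp
  from f_close[OF th_eventually th_lim this]
  have "\<forall>\<^sub>F n in sequentially. \<forall>v. \<exists>z\<in>XX. \<kappa> / 2 * norm v \<le> \<bar>f (th n) z \<bullet> v\<bar>"
  proof eventually_elim
    case (elim n)
    show ?case
    proof
      fix v
      obtain z where z: "z \<in> XX" "\<kappa> * norm v \<le> \<bar>f \<theta>bar z \<bullet> v\<bar>" using \<kappa>(2) by blast
      have "\<bar>(f (th n) z - f \<theta>bar z) \<bullet> v\<bar> \<le> norm (f (th n) z - f \<theta>bar z) * norm v"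
        by (rule Cauchy_Schwarz_ineq2)
      also have "\<dots> \<le> \<kappa> / 2 * norm v"
        using elim z(1) by (intro mult_right_mono) (auto intro: less_imp_le)
      finally have "\<kappa> / 2 * norm v \<le> \<bar>f (th n) z \<bullet> v\<bar>"
        using z(2) unfolding inner_diff_left by (simp add: abs_if split: if_splits)
      then show "\<exists>z\<in>XX. \<kappa> / 2 * norm v \<le> \<bar>f (th n) z \<bullet> v\<bar>" using z(1) by blast
    qed
  qed
  with \<open>\<kappa> / 2 > 0\<close> show ?thesis by (rule that)
qed

text \<open>
  Suppose the largest sensitivity exceeds \<open>D\<close> at all times in \<open>[m, 2m)\<close>. Each new regression vector is then far from all
  but a small fraction of its predecessors, so the cell that contains it has been visited rarely.
  With \<open>D\<close> sixteen times the number of cells, each cell accounts for too few of the \<open>m\<close> new points.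
\<close>
lemma sensitivity_bounded_often:
  obtains D where "D > 0"
    "\<forall>\<^sub>F m in sequentially. \<exists>n. m \<le> n \<and> n < 2 * m \<and> (\<forall>z\<in>XX. sensitivity n (th n) z \<le> D)"
proof -
  obtain \<kappa> where "\<kappa> > 0" and spread_ev:
    "\<forall>\<^sub>F n in sequentially. \<forall>v. \<exists>z\<in>XX. \<kappa> * norm v \<le> \<bar>f (th n) z \<bullet> v\<bar>"
    using spread_eventually by blast
  \<comment> \<open>Two points of one cell of radius \<open>r\<close> are within \<open>2 * r\<close> at \<open>\<theta>bar\<close>, hence within \<open>4 * r = \<kappa> / 2\<close> at \<open>th n\<close>.\<close>
  define r where "r = \<kappa> / 8"
  have pos: "\<kappa> > 0" "r > 0" using \<open>\<kappa> > 0\<close> by (auto simp: r_def)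
  have "continuous_on XX (f \<theta>bar)"
  proof -
    have "continuous_on XX (\<lambda>z. case (z, \<theta>bar) of (z, \<theta>) \<Rightarrow> f \<theta> z)"
      using regression \<theta>bar unfolding regression_family_def
      by (intro continuous_on_compose2[of "XX \<times> \<Theta>" "\<lambda>(z, \<theta>). f \<theta> z" XX "\<lambda>z. (z, \<theta>bar)"]
          continuous_intros) auto
    then show ?thesis by simp
  qed
  then have "compact (f \<theta>bar ` XX)" using compact_XX by (rule compact_continuous_image)
  then obtain K where K: "finite K" "f \<theta>bar ` XX \<subseteq> (\<Union>y\<in>K. ball y r)"
    using pos(2) unfolding compact_eq_totally_bounded by blast
  define cell where "cell i = (SOME y. y \<in> K \<and> f \<theta>bar (x i) \<in> ball y r)" for i
  have cell: "cell i \<in> K \<and> f \<theta>bar (x i) \<in> ball (cell i) r" if "i \<ge> 1" for i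
    unfolding cell_def by (rule someI_ex) (use K(2) x_in[OF that] in blast)
  have "card K > 0" using K cell[of 1] by (auto simp: card_gt_0_iff)
  define D where "D = 16 * real (card K)"
  have D: "D > 0" using \<open>card K > 0\<close> by (simp add: D_def)
  obtain n\<^sub>1 where n\<^sub>1: "\<And>n z. n \<ge> n\<^sub>1 \<Longrightarrow> z \<in> XX \<Longrightarrow> norm (f (th n) z - f \<theta>bar z) < r"
    using f_close[OF th_eventually th_lim pos(2)] by (auto simp: eventually_sequentially)
  obtain n\<^sub>2 where spread_th: "\<And>n v. n \<ge> n\<^sub>2 \<Longrightarrow> \<exists>z\<in>XX. \<kappa> * norm v \<le> \<bar>f (th n) z \<bullet> v\<bar>"
    using spread_ev by (auto simp: eventually_sequentially)
  define m\<^sub>0 where "m\<^sub>0 = max (max nst (max n\<^sub>1 n\<^sub>2)) (2 * card K + 1)"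
  \<comment> \<open>The term \<open>2 * card K + 1\<close> in \<open>m\<^sub>0\<close> refutes the bound \<open>m \<le> m / 2 + card K\<close> that the count yields.\<close>
  have bounded: "\<exists>n. m \<le> n \<and> n < 2 * m \<and> (\<forall>z\<in>XX. sensitivity n (th n) z \<le> D)" if m: "m \<ge> m\<^sub>0" for m
  proof (rule ccontr)
    assume contra: "\<not> ?thesis"
    have few: "real (card {i\<in>{1..n}. cell i = cell (Suc n)}) \<le> real m / (2 * real (card K))"
      if n: "m \<le> n" "n < 2 * m" for n
    proof -
      define h where "h = f (th n) (x (Suc n))"
      define T where "T = {i\<in>{1..n}. norm (f (th n) (x i) - h) \<le> \<kappa> / 2}"
      have n': "n \<ge> nst" "n \<ge> n\<^sub>1" "n \<ge> n\<^sub>2" "n \<ge> 1" using n m nst by (auto simp: m\<^sub>0_def)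
      have big: "D < h \<bullet> (matrix_inv (M n (th n)) *v h)"
        using contra n x_max[OF n'(1)] unfolding sensitivity_def h_def by (meson not_le order_trans)
      have "real (card T) * (h \<bullet> (matrix_inv (M n (th n)) *v h)) \<le> 4 * real n"
        unfolding T_def
      proof (rule few_points_near_direction[OF M_eq[OF n'(4)] M_pos_def[OF n'(1) th_in[OF n'(1)]] n'(4) pos(1)])
        show "\<exists>z\<in>f (th n) ` XX. \<kappa> * norm v \<le> \<bar>z \<bullet> v\<bar>" for v
          using spread_th[OF n'(3)] by blast
        show "z \<bullet> (matrix_inv (M n (th n)) *v z) \<le> h \<bullet> (matrix_inv (M n (th n)) *v h)"
          if "z \<in> f (th n) ` XX" for z
          using that x_max[OF n'(1)] by (auto simp: sensitivity_def h_def)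
      qed
      moreover have "real (card T) * D \<le> real (card T) * (h \<bullet> (matrix_inv (M n (th n)) *v h))"
        using big by (intro mult_left_mono) auto
      ultimately have cardT: "real (card T) * D \<le> 4 * real n" by linarith
      have "{i\<in>{1..n}. cell i = cell (Suc n)} \<subseteq> T"
      proof
        fix i assume i: "i \<in> {i\<in>{1..n}. cell i = cell (Suc n)}"
        have "dist (cell i) (f \<theta>bar (x i)) < r" "dist (cell i) (f \<theta>bar (x (Suc n))) < r"
          using cell[of i] cell[of "Suc n"] i by auto
        then have "norm (f \<theta>bar (x i) - f \<theta>bar (x (Suc n))) < r + r"
          using dist_triangle3[of "f \<theta>bar (x i)" "f \<theta>bar (x (Suc n))" "cell i"] by (simp add: dist_norm)
        moreover have "norm (f (th n) (x i) - f \<theta>bar (x i)) < r"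
          using i n' by (intro n\<^sub>1 x_in) auto
        moreover have "norm (f (th n) (x (Suc n)) - f \<theta>bar (x (Suc n))) < r"
          using n' by (intro n\<^sub>1 x_in) auto
        moreover have "norm (a - b) \<le> norm (a - a') + norm (a' - b') + norm (b - b')"
          for a b a' b' :: "real ^ 'p"
          by norm
        ultimately have "norm (f (th n) (x i) - h) \<le> r + (r + r) + r"
          unfolding h_def by (smt (verit, best))
        then show "i \<in> T" using i by (simp add: T_def r_def)
      qed
      then have "card {i\<in>{1..n}. cell i = cell (Suc n)} \<le> card T"
        by (intro card_mono) (auto simp: T_def)
      then have "real (card {i\<in>{1..n}. cell i = cell (Suc n)}) * D \<le> real (card T) * D"
        using D by (intro mult_right_mono) auto
      also have "\<dots> \<le> 8 * real m" using cardT n by simp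
      finally show ?thesis using \<open>card K > 0\<close> by (simp add: D_def field_simps)
    qed
    have "real m \<le> real (card K) * (real m / (2 * real (card K)) + 1)"
      using cell by (intro colour_count[OF K(1) _ few]) auto
    also have "\<dots> = real m / 2 + real (card K)" using \<open>card K > 0\<close> by (simp add: field_simps)
    finally show False using m by (simp add: m\<^sub>0_def)
  qed
  show ?thesis
    using bounded by (intro that[OF D]) (auto simp: eventually_sequentially)
qed

text \<open>
  At a time \<open>n\<close> of bounded sensitivities, the lower bound for \<open>M n (th n)\<close> follows from the Cauchy-Schwarz
  inequality and passes to \<open>M n \<theta>bar\<close>, as the two matrices are close. Every late \<open>l\<close> has such a
  time \<open>n\<close> with \<open>l \<le> 3 * n \<le> 3 * l\<close>, and monotonicity of \<open>n M\<^sub>n\<close> costs a factor three.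
\<close>
lemma M_eventually_coercive:
  obtains \<alpha> where "\<alpha> > 0" "\<forall>\<^sub>F n in sequentially. \<forall>v. \<alpha> * (norm v)\<^sup>2 \<le> v \<bullet> (M n \<theta>bar *v v)"
proof -
  obtain D where D: "D > 0" and often:
    "\<forall>\<^sub>F m in sequentially. \<exists>n. m \<le> n \<and> n < 2 * m \<and> (\<forall>z\<in>XX. sensitivity n (th n) z \<le> D)"
    using sensitivity_bounded_often by blast
  obtain \<kappa> where \<kappa>: "\<kappa> > 0" and spread_ev:
    "\<forall>\<^sub>F n in sequentially. \<forall>v. \<exists>z\<in>XX. \<kappa> * norm v \<le> \<bar>f (th n) z \<bullet> v\<bar>"
    using spread_eventually by blast
  define \<beta> where "\<beta> = \<kappa>\<^sup>2 / D"
  have \<beta>: "\<beta> > 0" using \<kappa> D by (simp add: \<beta>_def)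
  have "\<forall>\<^sub>F n in sequentially. dist (M n (th n) - M n \<theta>bar) 0 < \<beta> / 2"
    using \<beta> by (intro tendstoD[OF M_close[OF th_eventually th_lim]]) auto
  with often spread_ev eventually_ge_at_top[of nst]
  have "\<forall>\<^sub>F m in sequentially. m \<ge> nst
    \<and> (\<exists>n. m \<le> n \<and> n < 2 * m \<and> (\<forall>z\<in>XX. sensitivity n (th n) z \<le> D))
    \<and> (\<forall>v. \<exists>z\<in>XX. \<kappa> * norm v \<le> \<bar>f (th m) z \<bullet> v\<bar>)
    \<and> norm (M m (th m) - M m \<theta>bar) \<le> \<beta> / 2"
    by eventually_elim auto
  then obtain m\<^sub>1 where m\<^sub>1: "\<And>m. m \<ge> m\<^sub>1 \<Longrightarrow> m \<ge> nst"
    "\<And>m. m \<ge> m\<^sub>1 \<Longrightarrow> \<exists>n. m \<le> n \<and> n < 2 * m \<and> (\<forall>z\<in>XX. sensitivity n (th n) z \<le> D)"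
    "\<And>m v. m \<ge> m\<^sub>1 \<Longrightarrow> \<exists>z\<in>XX. \<kappa> * norm v \<le> \<bar>f (th m) z \<bullet> v\<bar>"
    "\<And>m. m \<ge> m\<^sub>1 \<Longrightarrow> norm (M m (th m) - M m \<theta>bar) \<le> \<beta> / 2"
    unfolding eventually_sequentially by blast
  have good: "\<beta> / 6 * (norm v)\<^sup>2 \<le> v \<bullet> (M l \<theta>bar *v v)" if l: "l \<ge> 2 * m\<^sub>1" for l v
  proof -
    define m where "m = l div 2"
    have "m \<ge> m\<^sub>1" using l by (simp add: m_def)
    then have m: "m \<ge> m\<^sub>1" "2 * m \<le> l" "l \<le> 2 * m + 1" "m \<ge> 1"
      using nst m\<^sub>1(1)[of m] by (auto simp: m_def)
    obtain n where n: "m \<le> n" "n < 2 * m" and sens: "\<And>z. z \<in> XX \<Longrightarrow> sensitivity n (th n) z \<le> D"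
      using m\<^sub>1(2)[OF m(1)] by blast
    have n': "n \<ge> nst" "n \<ge> m\<^sub>1" "n \<ge> 1" using n m m\<^sub>1(1)[of n] by auto
    have pd: "pos_def (M n (th n))" using n' th_in by (intro M_pos_def) auto
    have "\<beta> * (norm v)\<^sup>2 \<le> v \<bullet> (M n (th n) *v v)"
    proof -
      obtain z where z: "z \<in> XX" "\<kappa> * norm v \<le> \<bar>f (th n) z \<bullet> v\<bar>" using m\<^sub>1(3)[OF n'(2)] by blast
      have "(\<kappa> * norm v)\<^sup>2 \<le> (f (th n) z \<bullet> v)\<^sup>2"
        using power_mono[OF z(2), of 2] \<kappa> by simp
      also have "\<dots> \<le> sensitivity n (th n) z * (v \<bullet> (M n (th n) *v v))"
        unfolding sensitivity_def by (rule pos_def_inv_Cauchy_Schwarz(2)[OF pd])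
      also have "\<dots> \<le> D * (v \<bullet> (M n (th n) *v v))"
        by (intro mult_right_mono sens z pos_def_nonneg pd)
      finally show ?thesis using D by (simp add: \<beta>_def field_simps)
    qed
    from coercive_perturb[OF m\<^sub>1(4)[OF n'(2)] this]
    have "\<beta> / 2 * (norm v)\<^sup>2 \<le> v \<bullet> (M n \<theta>bar *v v)" by simp
    then have "real n * (\<beta> / 2 * (norm v)\<^sup>2) \<le> real n * (v \<bullet> (M n \<theta>bar *v v))"
      by (rule mult_left_mono) simp
    also have "\<dots> \<le> real l * (v \<bullet> (M l \<theta>bar *v v))"
      using n n' m by (intro M_mono) auto
    finally have 1: "real n * (\<beta> / 2 * (norm v)\<^sup>2) \<le> real l * (v \<bullet> (M l \<theta>bar *v v))" .
    have "real l \<le> 3 * real n" using n m by linarith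
    then have "real l * (\<beta> / 6 * (norm v)\<^sup>2) \<le> (3 * real n) * (\<beta> / 6 * (norm v)\<^sup>2)"
      using \<beta> by (intro mult_right_mono) auto
    also have "\<dots> = real n * (\<beta> / 2 * (norm v)\<^sup>2)" by simp
    finally have "real l * (\<beta> / 6 * (norm v)\<^sup>2) \<le> real l * (v \<bullet> (M l \<theta>bar *v v))"
      using 1 by linarith
    then show ?thesis using n n' m by (simp add: mult_le_cancel_left)
  qed
  show ?thesis
    by (rule that[of "\<beta> / 6"]) (use \<beta> good in \<open>auto simp: eventually_sequentially\<close>)
qed

section \<open>Convergence along a path\<close>

text \<open>
  The new point maximises the sensitivity at \<open>th n\<close>; the lower bound on the information matrices makes the
  sensitivities at \<open>th n\<close> and at \<open>\<theta>bar\<close> uniformly close.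
\<close>
lemma nearly_optimal_direction:
  assumes "e > 0"
  shows "\<forall>\<^sub>F n in sequentially. \<forall>z\<in>XX. sensitivity n \<theta>bar z \<le> sensitivity n \<theta>bar (x (Suc n)) + e"
proof -
  obtain \<alpha> where \<alpha>: "\<alpha> > 0"
    and coer: "\<forall>\<^sub>F n in sequentially. \<forall>v. \<alpha> * (norm v)\<^sup>2 \<le> v \<bullet> (M n \<theta>bar *v v)"
    using M_eventually_coercive by blast
  obtain C where C: "C > 0" "\<And>z \<theta>. z \<in> XX \<Longrightarrow> \<theta> \<in> \<Theta> \<Longrightarrow> norm (f \<theta> z) \<le> C"
    using f_bounded by blast
  define L where "L = C / (\<alpha> / 2)"
  have L: "L > 0" using C \<alpha> by (simp add: L_def)
  have 1: "\<forall>\<^sub>F n in sequentially. dist (M n (th n) - M n \<theta>bar) 0 < min (\<alpha> / 2) (e / (4 * L\<^sup>2))"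
    using \<alpha> L assms by (intro tendstoD[OF M_close[OF th_eventually th_lim]]) auto
  have 2: "\<forall>\<^sub>F n in sequentially. \<forall>z\<in>XX. norm (f (th n) z - f \<theta>bar z) < e / (8 * L)"
    using L assms by (intro f_close th_eventually th_lim) auto
  from 1 2 coer eventually_ge_at_top[of nst] show ?thesis
  proof eventually_elim
    case (elim n)
    have thn: "th n \<in> \<Theta>" using elim(4) by (rule th_in)
    define \<delta> where "\<delta> = norm (M n \<theta>bar - M n (th n))"
    have \<delta>: "\<delta> < \<alpha> / 2" "\<delta> < e / (4 * L\<^sup>2)"
      using elim(1) by (auto simp: \<delta>_def norm_minus_commute)
    have cA: "\<alpha> / 2 * (norm v)\<^sup>2 \<le> v \<bullet> (M n \<theta>bar *v v)" for v
    proof -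
      have "\<alpha> / 2 * (norm v)\<^sup>2 \<le> \<alpha> * (norm v)\<^sup>2" using \<alpha> by simp
      then show ?thesis using elim(3) order_trans by blast
    qed
    have cB: "\<alpha> / 2 * (norm v)\<^sup>2 \<le> v \<bullet> (M n (th n) *v v)" for v
      using coercive_perturb[of "M n \<theta>bar" "M n (th n)" "\<alpha> / 2" \<alpha> v] \<delta>(1) elim(3) by (simp add: \<delta>_def)
    have close: "\<bar>sensitivity n \<theta>bar z - sensitivity n (th n) z\<bar> \<le> e / 2" if z: "z \<in> XX" for z
    proof -
      have "\<bar>sensitivity n \<theta>bar z - sensitivity n (th n) z\<bar>
        \<le> L\<^sup>2 * \<delta> + 2 * L * norm (f \<theta>bar z - f (th n) z)"
        unfolding sensitivity_def L_def \<delta>_def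
        using \<alpha> z thn \<theta>bar C(2) elim(4)
        by (intro inverse_form_perturbation M_pos_def cA cB) auto
      also have "\<dots> \<le> L\<^sup>2 * (e / (4 * L\<^sup>2)) + 2 * L * (e / (8 * L))"
        using elim(2) z \<delta>(2) L
        by (intro add_mono mult_left_mono) (auto simp: norm_minus_commute intro: less_imp_le)
      also have "\<dots> = e / 2" using L by (simp add: field_simps)
      finally show ?thesis .
    qed
    show ?case
    proof
      fix z assume z: "z \<in> XX"
      show "sensitivity n \<theta>bar z \<le> sensitivity n \<theta>bar (x (Suc n)) + e"
        using close[OF z] close[OF x_in[of "Suc n"]] x_max[OF elim(4) z] by linarith
    qed
  qed
qed

lemma M_Suc:
  assumes "n \<ge> 1"
  shows "M (Suc n) \<theta> = (real n / real (Suc n)) *\<^sub>R (M n \<theta> + (1 / real n) *\<^sub>R outer (f \<theta> (x (Suc n))))"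
proof -
  have "real (Suc n) *\<^sub>R M (Suc n) \<theta> = (\<Sum>i=1..Suc n. outer (f \<theta> (x i)))"
    by (simp add: M_eq weighted_gram_def scaleR_sum_right del: sum.cl_ivl_Suc)
  also have "\<dots> = real n *\<^sub>R M n \<theta> + outer (f \<theta> (x (Suc n)))"
    using assms by (simp add: M_eq weighted_gram_def scaleR_sum_right)
  also have "\<dots> = real n *\<^sub>R (M n \<theta> + (1 / real n) *\<^sub>R outer (f \<theta> (x (Suc n))))"
    using assms by (simp add: scaleR_add_right)
  finally have "(1 / real (Suc n)) *\<^sub>R (real (Suc n) *\<^sub>R M (Suc n) \<theta>)
    = (1 / real (Suc n)) *\<^sub>R (real n *\<^sub>R (M n \<theta> + (1 / real n) *\<^sub>R outer (f \<theta> (x (Suc n)))))"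
    by simp
  then show ?thesis by simp
qed

text \<open>
  The ascent of one step: \<open>d/n\<close> from the rank-one update up to a second-order error, and the loss \<open>p/n\<close>
  from renormalising the weights by the factor \<open>n / (n + 1)\<close>.
\<close>
lemma ln_det_M_Suc_ge:
  assumes n: "n \<ge> nst" and Q: "sensitivity n \<theta>bar (x (Suc n)) \<le> Q" "Q \<le> real n"
  shows "ln (det (M n \<theta>bar)) + (sensitivity n \<theta>bar (x (Suc n)) - real CARD('p)) / real n - Q\<^sup>2 / (real n)\<^sup>2
    \<le> ln (det (M (Suc n) \<theta>bar))"
proof -
  define d where "d = sensitivity n \<theta>bar (x (Suc n))"
  define p where "p = CARD('p)"
  have n1: "n \<ge> 1" using n nst by simp
  have pd: "pos_def (M n \<theta>bar)" by (rule M_pos_def[OF n \<theta>bar])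
  have det0: "det (M n \<theta>bar) > 0" by (rule pos_def_det_pos[OF pd])
  have d: "0 \<le> d" "d \<le> Q" "d \<le> real n"
    using Q pos_def_inv_nonneg[OF pd] by (auto simp: d_def sensitivity_def)
  have ratio: "ln (real n / real (Suc n)) \<ge> - (1 / real n)"
  proof -
    have "real n / real (Suc n) = inverse (1 + 1 / real n)" using n1 by (simp add: field_simps)
    then show ?thesis using ln_add_one_self_le_self[of "1 / real n"] n1 
      by (simp add: ln_inverse add_pos_nonneg)
  qed
  have "det (M n \<theta>bar) * (1 + 1 / real n * d) \<le> det (M n \<theta>bar + (1 / real n) *\<^sub>R outer (f \<theta>bar (x (Suc n))))"
    unfolding d_def sensitivity_def by (rule det_rank_one_update_ge[OF pd]) simp
  then have det_ge: "(real n / real (Suc n)) ^ p * (det (M n \<theta>bar) * (1 + d / real n)) \<le> det (M (Suc n) \<theta>bar)"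
    by (simp add: M_Suc[OF n1] det_scaleR p_def mult_left_mono)
  have pos: "1 + d / real n > 0" "real n / real (Suc n) > 0"
    using d n1 by (auto intro: add_pos_nonneg)
  have "d / real n - (d / real n)\<^sup>2 \<le> ln (1 + d / real n)"
    using d n1 by (intro ln_one_plus_pos_lower_bound) auto
  moreover have "(d / real n)\<^sup>2 \<le> Q\<^sup>2 / (real n)\<^sup>2"
    using d unfolding power_divide by (intro divide_right_mono power_mono) auto
  moreover have "real p * - (1 / real n) \<le> real p * ln (real n / real (Suc n))"
    by (intro mult_left_mono ratio) simp
  ultimately have "ln (det (M n \<theta>bar)) + (d - real p) / real n - Q\<^sup>2 / (real n)\<^sup>2
    \<le> real p * ln (real n / real (Suc n)) + (ln (det (M n \<theta>bar)) + ln (1 + d / real n))"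
    by (simp add: diff_divide_distrib)
  also have "\<dots> = ln ((real n / real (Suc n)) ^ p * (det (M n \<theta>bar) * (1 + d / real n)))"
    using det0 pos n1 by (simp add: ln_mult ln_realpow del: of_nat_Suc)
  also have "\<dots> \<le> ln (det (M (Suc n) \<theta>bar))"
    using det0 pos by (intro ln_mono det_ge mult_pos_pos zero_less_power)
  finally show ?thesis by (simp add: d_def p_def)
qed

lemma M_norm_bounded:
  obtains R where "\<And>n. n \<ge> 1 \<Longrightarrow> norm (M n \<theta>bar) \<le> R"
proof -
  obtain C where C: "C > 0" "\<And>z \<theta>. z \<in> XX \<Longrightarrow> \<theta> \<in> \<Theta> \<Longrightarrow> norm (f \<theta> z) \<le> C"
    using f_bounded by blast
  have "compact (outer ` cball (0 :: real ^ 'p) C)"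
    by (intro compact_continuous_image continuous_on_outer compact_cball)
  then have "bounded (outer ` cball (0 :: real ^ 'p) C)" by (rule compact_imp_bounded)
  then obtain R where "\<forall>B\<in>outer ` cball (0 :: real ^ 'p) C. norm B \<le> R"
    unfolding bounded_iff by blast
  then have R: "norm (outer a) \<le> R" if "norm a \<le> C" for a :: "real ^ 'p"
    using that by simp
  have "norm (M n \<theta>bar) \<le> R" if "n \<ge> 1" for n
  proof -
    have "norm (M n \<theta>bar) \<le> real (card {1..n}) * (1 / real n * R)"
      unfolding M_eq[OF that] weighted_gram_def
      by (intro sum_norm_bound) (auto intro!: divide_right_mono R C x_in \<theta>bar)
    also have "\<dots> = R" using that by simp
    finally show ?thesis .
  qed
  then show ?thesis by (rule that)
qed

text \<open>
  The gap \<open>\<Delta>\<close> obeys the relaxation recursion: by concavity it is at most the largest sensitivity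
  minus \<open>p\<close>, and by near-optimality of the new point one step recovers the \<open>n\<close>-th part of that bound.
\<close>
lemma det_M_tendsto_optimal:
  assumes opt: "locally_D_optimal XX f \<theta>bar \<xi>"
  shows "(\<lambda>n. det (M n \<theta>bar)) \<longlonglongrightarrow> det (info f \<xi> \<theta>bar)"
proof -
  define Mopt where "Mopt = info f \<xi> \<theta>bar"
  have \<xi>: "design XX \<xi>" and max: "\<And>\<eta>. design XX \<eta> \<Longrightarrow> det (info f \<eta> \<theta>bar) \<le> det Mopt"
    using opt by (auto simp: locally_D_optimal_def is_arg_max_linorder Mopt_def)
  have emp: "design XX (empirical_design n x)" if "n \<ge> 1" for n
    using that x_in by (rule design_empirical)
  have det_pos: "det (M n \<theta>bar) > 0" if "n \<ge> nst" for n
    by (intro pos_def_det_pos M_pos_def that \<theta>bar)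
  have det_le: "det (M n \<theta>bar) \<le> det Mopt" if "n \<ge> 1" for n
    using max[OF emp[OF that]] by (simp add: M_def)
  have Mopt_pos: "det Mopt > 0" using det_pos[OF order_refl] det_le[OF nst] by linarith
  obtain \<alpha> where \<alpha>: "\<alpha> > 0"
    and coer: "\<forall>\<^sub>F n in sequentially. \<forall>v. \<alpha> * (norm v)\<^sup>2 \<le> v \<bullet> (M n \<theta>bar *v v)"
    using M_eventually_coercive by blast
  obtain C where C: "C > 0" "\<And>z \<theta>. z \<in> XX \<Longrightarrow> \<theta> \<in> \<Theta> \<Longrightarrow> norm (f \<theta> z) \<le> C"
    using f_bounded by blast
  define \<Delta> where "\<Delta> n = ln (det Mopt) - ln (det (M n \<theta>bar))" for n
  have \<Delta>_nonneg: "0 \<le> \<Delta> n" if "n \<ge> nst" for n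
    using det_le[of n] det_pos[OF that] that nst by (simp add: \<Delta>_def)
  have gap: "\<Delta> n \<le> s - real CARD('p)"
    if n: "n \<ge> nst" and s: "\<And>z. z \<in> XX \<Longrightarrow> sensitivity n \<theta>bar z \<le> s" for n s
  proof -
    have "(\<Sum>z\<in>set_pmf \<xi>. pmf \<xi> z * sensitivity n \<theta>bar z) \<le> (\<Sum>z\<in>set_pmf \<xi>. pmf \<xi> z * s)"
      using \<xi> by (intro sum_mono mult_left_mono s) (auto simp: design_def)
    also have "\<dots> = s"
      using \<xi> by (simp add: design_def sum_pmf_eq_1 flip: sum_distrib_right)
    finally have "det (M n \<theta>bar) * exp ((\<Sum>z\<in>set_pmf \<xi>. pmf \<xi> z * sensitivity n \<theta>bar z) - real CARD('p))
      \<le> det (M n \<theta>bar) * exp (s - real CARD('p))"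
      using det_pos[OF n] by simp
    moreover have "det Mopt \<le> det (M n \<theta>bar) * exp ((\<Sum>z\<in>set_pmf \<xi>. pmf \<xi> z * sensitivity n \<theta>bar z) - real CARD('p))"
      unfolding Mopt_def info_eq_weighted_gram sensitivity_def
      by (intro det_weighted_gram_le M_pos_def n \<theta>bar) simp
    ultimately have "ln (det Mopt) \<le> ln (det (M n \<theta>bar) * exp (s - real CARD('p)))"
      using Mopt_pos by (intro ln_mono) auto
    then show ?thesis using det_pos[OF n] by (simp add: \<Delta>_def ln_mult)
  qed
  define Q where "Q = C\<^sup>2 / \<alpha>"
  have "\<Delta> \<longlonglongrightarrow> 0"
  proof (rule relaxation_tendsto_zero)
    show "\<forall>\<^sub>F n in sequentially. 0 \<le> \<Delta> n"
      using eventually_ge_at_top[of nst] by eventually_elim (rule \<Delta>_nonneg)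
    fix e :: real assume "e > 0"
    have "(\<lambda>n. Q\<^sup>2 / real n) \<longlonglongrightarrow> 0" by real_asymp
    then have 1: "\<forall>\<^sub>F n in sequentially. dist (Q\<^sup>2 / real n) 0 < e / 2"
      by (rule tendstoD) (use \<open>e > 0\<close> in simp)
    have 2: "\<forall>\<^sub>F n in sequentially. \<forall>z\<in>XX. sensitivity n \<theta>bar z \<le> sensitivity n \<theta>bar (x (Suc n)) + e / 2"
      by (rule nearly_optimal_direction) (use \<open>e > 0\<close> in simp)
    from 1 2 coer eventually_ge_at_top[of nst] eventually_ge_at_top[of "nat \<lceil>Q\<rceil>"]
    show "\<forall>\<^sub>F n in sequentially. \<Delta> (Suc n) \<le> \<Delta> n + (e - \<Delta> n) / real n"
    proof eventually_elim
      case (elim n)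
      define d where "d = sensitivity n \<theta>bar (x (Suc n))"
      define g where "g = f \<theta>bar (x (Suc n))"
      have n0: "real n > 0" using elim(4) nst by simp
      have pd: "pos_def (M n \<theta>bar)" by (intro M_pos_def elim \<theta>bar)
      have "g \<bullet> (matrix_inv (M n \<theta>bar) *v g) \<le> norm g * norm (matrix_inv (M n \<theta>bar) *v g)"
        by (rule norm_cauchy_schwarz)
      also have "\<dots> \<le> norm g * (norm g / \<alpha>)"
        using elim(3) by (intro mult_left_mono norm_inverse_le[OF pd \<alpha>]) auto
      also have "\<dots> \<le> C * (C / \<alpha>)"
        using C \<theta>bar x_in[of "Suc n"] \<alpha> by (intro mult_mono divide_right_mono) (auto simp: g_def)
      finally have dQ: "d \<le> Q" by (simp add: d_def g_def Q_def sensitivity_def power2_eq_square)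
      have "ln (det (M n \<theta>bar)) + (d - real CARD('p)) / real n - Q\<^sup>2 / (real n)\<^sup>2 \<le> ln (det (M (Suc n) \<theta>bar))"
        using dQ elim(4,5) unfolding d_def by (intro ln_det_M_Suc_ge) linarith+
      then have "\<Delta> (Suc n) \<le> \<Delta> n - (d - real CARD('p)) / real n + Q\<^sup>2 / (real n)\<^sup>2"
        by (simp add: \<Delta>_def)
      moreover have "(\<Delta> n - e / 2) / real n \<le> (d - real CARD('p)) / real n"
        using gap[OF elim(4), of "d + e / 2"] elim(2) n0 by (intro divide_right_mono) (auto simp: d_def)
      moreover have "Q\<^sup>2 / (real n)\<^sup>2 \<le> e / 2 / real n"
        using elim(1) n0 by (simp add: power2_eq_square field_simps)
      moreover have "(e - \<Delta> n) / real n = e / 2 / real n - (\<Delta> n - e / 2) / real n"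
        using n0 by (simp add: field_simps)
      ultimately show ?case by linarith
    qed
  qed
  then have "(\<lambda>n. exp (ln (det Mopt) - \<Delta> n)) \<longlonglongrightarrow> exp (ln (det Mopt) - 0)"
    by (intro tendsto_intros)
  moreover have "\<forall>\<^sub>F n in sequentially. exp (ln (det Mopt) - \<Delta> n) = det (M n \<theta>bar)"
    using eventually_ge_at_top[of nst] by eventually_elim (simp add: \<Delta>_def det_pos)
  ultimately show ?thesis
    using Mopt_pos by (simp add: tendsto_cong Mopt_def)
qed

lemma M_tendsto_optimal:
  assumes opt: "locally_D_optimal XX f \<theta>bar \<xi>"
  shows "(\<lambda>n. M n \<theta>bar) \<longlonglongrightarrow> info f \<xi> \<theta>bar"
proof -
  obtain \<alpha> where \<alpha>: "\<alpha> > 0"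
    and coer: "\<forall>\<^sub>F n in sequentially. \<forall>v. \<alpha> * (norm v)\<^sup>2 \<le> v \<bullet> (M n \<theta>bar *v v)"
    using M_eventually_coercive by blast
  obtain R where R: "\<And>n. n \<ge> 1 \<Longrightarrow> norm (M n \<theta>bar) \<le> R" using M_norm_bounded by blast
  have \<xi>: "design XX \<xi>" and max: "\<And>\<eta>. design XX \<eta> \<Longrightarrow> det (info f \<eta> \<theta>bar) \<le> det (info f \<xi> \<theta>bar)"
    using opt by (auto simp: locally_D_optimal_def is_arg_max_linorder)
  have mid: "det ((1/2) *\<^sub>R M n \<theta>bar + (1/2) *\<^sub>R info f \<xi> \<theta>bar) \<le> det (info f \<xi> \<theta>bar)"
    if n: "n \<ge> 1" for n
  proof -
    have "design XX (empirical_design n x)" using n x_in by (rule design_empirical)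
    from design_midpoint[OF this \<xi>, of f \<theta>bar]
    obtain \<zeta> where "design XX \<zeta>"
      and "info f \<zeta> \<theta>bar = (1/2) *\<^sub>R M n \<theta>bar + (1/2) *\<^sub>R info f \<xi> \<theta>bar"
      unfolding M_def by blast
    then show ?thesis using max[of \<zeta>] by simp
  qed
  show ?thesis
  proof (rule tendsto_if_det_tendsto[OF \<alpha> _ _ _ det_M_tendsto_optimal[OF opt]])
    show "transpose (info f \<xi> \<theta>bar) = info f \<xi> \<theta>bar"
      by (simp add: info_eq_weighted_gram transpose_weighted_gram)
    show "0 \<le> v \<bullet> (info f \<xi> \<theta>bar *v v)" for v
      by (simp add: info_eq_weighted_gram weighted_gram_quadratic sum_nonneg)
    show "\<forall>\<^sub>F n in sequentially. norm (M n \<theta>bar) \<le> R \<and> transpose (M n \<theta>bar) = M n \<theta>bar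
        \<and> (\<forall>v. \<alpha> * (norm v)\<^sup>2 \<le> v \<bullet> (M n \<theta>bar *v v))
        \<and> det ((1/2) *\<^sub>R M n \<theta>bar + (1/2) *\<^sub>R info f \<xi> \<theta>bar) \<le> det (info f \<xi> \<theta>bar)"
      using coer eventually_ge_at_top[of 1]
    proof eventually_elim
      case (elim n)
      then show ?case
        using R mid by (simp add: M_eq transpose_weighted_gram)
    qed
  qed
qed

lemma info_tendsto_optimal:
  assumes "locally_D_optimal XX f \<theta>bar \<xi>"
    and "\<forall>\<^sub>F n in sequentially. t n \<in> \<Theta>" and "t \<longlonglongrightarrow> \<theta>bar"
  shows "(\<lambda>n. info f (empirical_design n x) (t n)) \<longlonglongrightarrow> info f \<xi> \<theta>bar"
  using tendsto_add[OF M_close[OF assms(2,3)] M_tendsto_optimal[OF assms(1)]]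
  by (simp add: M_def)

end

section \<open>Almost sure convergence\<close>

lemma estimate_in_parameter_set:
  fixes XX :: "'x::metric_space set" and \<Theta> :: "'t::metric_space set"
  assumes "estimator XX \<Theta> n (est n)"
    and "\<And>i. i \<ge> 1 \<Longrightarrow> X i \<in> measurable P (restrict_space borel XX)" and "\<omega> \<in> space P"
  shows "estimate est X Y n \<omega> \<in> \<Theta>"
proof -
  have "X i \<omega> \<in> XX" if "i \<ge> 1" for i
    using measurable_space[OF assms(2)[OF that] assms(3)] by (simp add: space_restrict_space)
  then have "(\<lambda>i\<in>{1..n}. (X i \<omega>, Y i \<omega>))
      \<in> space (PiM {1..n} (\<lambda>_. restrict_space borel XX \<Otimes>\<^sub>M (borel :: real measure)))"
    by (auto simp: space_PiM space_pair_measure space_restrict_space)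
  from measurable_space[OF assms(1)[unfolded estimator_def] this]
  show ?thesis by (simp add: estimate_def space_restrict_space)
qed

theorem corollary3p2:
  fixes XX :: "'x::metric_space set"
    and \<Theta> :: "'t::metric_space set"
    and f :: "'t \<Rightarrow> 'x \<Rightarrow> real ^ 'p"
    and P :: "'w measure"
    and X :: "nat \<Rightarrow> 'w \<Rightarrow> 'x"
    and Y :: "nat \<Rightarrow> 'w \<Rightarrow> real"
    and est est' :: "nat \<Rightarrow> (nat \<Rightarrow> 'x \<times> real) \<Rightarrow> 't"
    and nst :: nat
    and \<theta>bar :: 't
    and \<xi>opt :: "'x pmf"
  assumes "compact XX" and "XX \<noteq> {}"
    and "compact \<Theta>" and "\<theta>bar \<in> \<Theta>"
    and "regression_family XX \<Theta> f"
    and "prob_space P"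
    and "\<And>i. i \<ge> 1 \<Longrightarrow> X i \<in> measurable P (restrict_space borel XX)"
    and "\<And>i. i \<ge> 1 \<Longrightarrow> Y i \<in> borel_measurable P"
    and "nst \<ge> 1"
    and "\<And>n. n \<ge> nst \<Longrightarrow> estimator XX \<Theta> n (est n)"
    and "\<And>\<omega>. \<omega> \<in> space P \<Longrightarrow>
           adaptive_wynn_path XX \<Theta> f nst (\<lambda>n. estimate est X Y n \<omega>) (\<lambda>i. X i \<omega>)"
    and "AE \<omega> in P. (\<lambda>n. estimate est X Y n \<omega>) \<longlonglongrightarrow> \<theta>bar"
    and "\<And>n. n \<ge> nst \<Longrightarrow> estimator XX \<Theta> n (est' n)"
    and "AE \<omega> in P. (\<lambda>n. estimate est' X Y n \<omega>) \<longlonglongrightarrow> \<theta>bar"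
    and "locally_D_optimal XX f \<theta>bar \<xi>opt"
  shows "AE \<omega> in P.
    (\<lambda>n. info f (empirical_design n (\<lambda>i. X i \<omega>)) (estimate est' X Y n \<omega>))
      \<longlonglongrightarrow> info f \<xi>opt \<theta>bar"
proof -
  have X_in: "X i \<omega> \<in> XX" if "\<omega> \<in> space P" "i \<ge> 1" for i \<omega>
    using measurable_space[OF assms(7)[OF that(2)] that(1)] by (simp add: space_restrict_space)
  have "AE \<omega> in P. \<omega> \<in> space P" by (rule AE_space)
  with assms(12,14) show ?thesis
  proof eventually_elim
    case (elim \<omega>)
    interpret convergent_wynn_path XX \<Theta> f nst "\<lambda>n. estimate est X Y n \<omega>" "\<lambda>i. X i \<omega>" \<theta>bar
    proof
      show "estimate est X Y n \<omega> \<in> \<Theta>" if "n \<ge> nst" for n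
        by (rule estimate_in_parameter_set[where est = est and X = X and n = n, OF assms(10)[OF that] assms(7) elim(3)])
    qed (use assms elim X_in in auto)
    have "\<forall>\<^sub>F n in sequentially. estimate est' X Y n \<omega> \<in> \<Theta>"
      using eventually_ge_at_top[of nst]
    proof eventually_elim
      case n: (elim n)
      show ?case by (rule estimate_in_parameter_set[where est = est' and X = X and n = n, OF assms(13)[OF n] assms(7) elim(3)])
    qed
    then show ?case by (rule info_tendsto_optimal[OF assms(15) _ elim(2)])
  qed
qed

end
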